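(* Suppose $\langle\mathbb A,\sigma\restriction\mathbb A\rangle$ is a countable elementary substructure of $\langle\mathcal P(\omega)/\mathrm{Fin},\sigma\rangle$. Then every embedding of $\langle\mathbb A,\sigma\restriction\mathbb A\rangle$ into $\langle\mathcal P(\omega)/\mathrm{Fin},\sigma\rangle$ is an elementary embedding.
   Context: $\mathcal P(\omega)/\mathrm{Fin}$ is $\mathcal P(\omega)$ modulo finite sets, $\sigma([A])=[A+1]$. An embedding of dynamical systems $\langle\mathbb A,\alpha\rangle\to\langle\mathbb B,\beta\rangle$ is an injective Boolean homomorphism $\eta$ with $\eta\circ\alpha=\beta\circ\eta$; it is elementary if for every first-order formula $\varphi$ and $a_1,\dots,a_n\in\mathbb A$, $\langle\mathbb A,\alpha\rangle\models\varphi(a_1,\dots,a_n)$ iff $\langle\mathbb B,\beta\rangle\models\varphi(\eta(a_1),\dots,\eta(a_n))$, in the language with constants $\mathbf 0,\mathbf 1$, Boolean operations, $\le$, and unary symbols for the automorphism and its inverse. An elementary substructure is a subalgebra closed under $\sigma,\sigma^{-1}$ whose inclusion is an elementary embedding. No hypothesis beyond ZFC. *)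

theory Defs
  imports Main "HOL-Library.Countable_Set"
begin

section \<open>The Boolean algebra of subsets of the naturals modulo finite sets\<close>

definition eq_fin :: "nat set \<Rightarrow> nat set \<Rightarrow> bool" where
  "eq_fin A B \<longleftrightarrow> finite ((A - B) \<union> (B - A))"

quotient_type pfin = "nat set" / eq_fin
proof (rule equivpI)
  show "reflp eq_fin" by (auto simp: reflp_def eq_fin_def)
  show "symp eq_fin" by (auto simp: symp_def eq_fin_def)
  show "transp eq_fin"
  proof (rule transpI)
    fix A B C assume "eq_fin A B" "eq_fin B C"
    then have "finite (((A - B) \<union> (B - A)) \<union> ((B - C) \<union> (C - B)))"
      by (simp add: eq_fin_def)
    then show "eq_fin A C"
      unfolding eq_fin_def by (rule rev_finite_subset) auto
  qed
qed

instantiation pfin :: boolean_algebra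
begin

lift_definition bot_pfin :: pfin is "{}" .

lift_definition top_pfin :: pfin is UNIV .

lift_definition sup_pfin :: "pfin \<Rightarrow> pfin \<Rightarrow> pfin" is "(\<union>)"
  unfolding eq_fin_def
  subgoal for A B C D
    by (rule finite_subset[of _ "((A - B) \<union> (B - A)) \<union> ((C - D) \<union> (D - C))"]) auto
  done

lift_definition inf_pfin :: "pfin \<Rightarrow> pfin \<Rightarrow> pfin" is "(\<inter>)"
  unfolding eq_fin_def
  subgoal for A B C D
    by (rule finite_subset[of _ "((A - B) \<union> (B - A)) \<union> ((C - D) \<union> (D - C))"]) auto
  done

lift_definition minus_pfin :: "pfin \<Rightarrow> pfin \<Rightarrow> pfin" is "(-)"
  unfolding eq_fin_def
  subgoal for A B C D
    by (rule finite_subset[of _ "((A - B) \<union> (B - A)) \<union> ((C - D) \<union> (D - C))"]) auto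
  done

lift_definition uminus_pfin :: "pfin \<Rightarrow> pfin" is uminus
  unfolding eq_fin_def
  subgoal for A B
    by (rule finite_subset[of _ "(A - B) \<union> (B - A)"]) auto
  done

lift_definition less_eq_pfin :: "pfin \<Rightarrow> pfin \<Rightarrow> bool" is "\<lambda>A B. finite (A - B)"
  unfolding eq_fin_def
  subgoal for A B C D
    apply (rule iffI)
    subgoal by (rule finite_subset[of _ "(A - C) \<union> ((A - B) \<union> (B - A)) \<union> ((C - D) \<union> (D - C))"]) auto
    subgoal by (rule finite_subset[of _ "(B - D) \<union> ((A - B) \<union> (B - A)) \<union> ((C - D) \<union> (D - C))"]) auto
    done
  done

definition less_pfin :: "pfin \<Rightarrow> pfin \<Rightarrow> bool" where
  "less_pfin a b \<longleftrightarrow> a \<le> b \<and> \<not> b \<le> a"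

instance
proof
  fix x y z :: pfin
  show "x < y \<longleftrightarrow> x \<le> y \<and> \<not> y \<le> x" by (rule less_pfin_def)
  show "x \<le> x" by transfer simp
  show "x \<le> y \<Longrightarrow> y \<le> z \<Longrightarrow> x \<le> z"
  proof transfer
    fix A B C :: "nat set" assume "finite (A - B)" "finite (B - C)"
    then have "finite ((A - B) \<union> (B - C))" by simp
    then show "finite (A - C)" by (rule rev_finite_subset) auto
  qed
  show "x \<le> y \<Longrightarrow> y \<le> x \<Longrightarrow> x = y" by transfer (simp add: eq_fin_def)
  show "inf x y \<le> x" by transfer (simp add: Diff_eq Int_assoc Int_left_commute)
  show "inf x y \<le> y" by transfer (simp add: Diff_eq Int_assoc)
  show "x \<le> y \<Longrightarrow> x \<le> z \<Longrightarrow> x \<le> inf y z" by transfer (simp add: Diff_Int)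
  show "x \<le> sup x y" by transfer (simp add: Diff_eq flip: Int_assoc)
  show "y \<le> sup x y" by transfer (simp add: Diff_eq Int_left_commute)
  show "y \<le> x \<Longrightarrow> z \<le> x \<Longrightarrow> sup y z \<le> x" by transfer (simp add: Un_Diff)
  show "bot \<le> x" by transfer simp
  show "x \<le> top" by transfer simp
  show "sup x (inf y z) = inf (sup x y) (sup x z)"
    by transfer (simp add: Un_Int_distrib eq_fin_def)
  show "inf x (- x) = bot" by transfer (simp add: eq_fin_def)
  show "sup x (- x) = top" by transfer (simp add: eq_fin_def)
  show "x - y = inf x (- y)" by transfer (simp add: Diff_eq eq_fin_def)
qed

end

lift_definition shift :: "pfin \<Rightarrow> pfin" is "\<lambda>A. Suc ` A"
  unfolding eq_fin_def
  subgoal for A B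
    by (rule finite_subset[of _ "Suc ` ((A - B) \<union> (B - A))"]) auto
  done


section \<open>Dynamical systems, embeddings\<close>

text \<open>
  A dynamical system is given by a carrier inside an ambient Boolean algebra and a map
  \<open>\<alpha>\<close>, of which only the values on the carrier are relevant; thus a pair \<open>A\<close>, \<open>\<alpha>\<close> stands for
  the system consisting of \<open>A\<close> and the restriction of \<open>\<alpha>\<close> to \<open>A\<close>.
\<close>

definition subalgebra :: "'a::boolean_algebra set \<Rightarrow> bool" where
  "subalgebra A \<longleftrightarrow> bot \<in> A \<and> top \<in> A \<and> (\<forall>x\<in>A. - x \<in> A) \<and>
     (\<forall>x\<in>A. \<forall>y\<in>A. sup x y \<in> A \<and> inf x y \<in> A)"

definition boolean_hom ::
  "'a::boolean_algebra set \<Rightarrow> 'b::boolean_algebra set \<Rightarrow> ('a \<Rightarrow> 'b) \<Rightarrow> bool" where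
  "boolean_hom A B h \<longleftrightarrow> (\<forall>x\<in>A. h x \<in> B) \<and> h bot = bot \<and> h top = top \<and>
     (\<forall>x\<in>A. h (- x) = - h x) \<and>
     (\<forall>x\<in>A. \<forall>y\<in>A. h (sup x y) = sup (h x) (h y) \<and> h (inf x y) = inf (h x) (h y))"

definition dynamical_system :: "'a::boolean_algebra set \<Rightarrow> ('a \<Rightarrow> 'a) \<Rightarrow> bool" where
  "dynamical_system A \<alpha> \<longleftrightarrow> subalgebra A \<and> boolean_hom A A \<alpha> \<and> bij_betw \<alpha> A A"

definition embedding ::
  "'a::boolean_algebra set \<Rightarrow> ('a \<Rightarrow> 'a) \<Rightarrow> 'b::boolean_algebra set \<Rightarrow> ('b \<Rightarrow> 'b) \<Rightarrow> ('a \<Rightarrow> 'b) \<Rightarrow> bool"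
  where
  "embedding A \<alpha> B \<beta> \<eta> \<longleftrightarrow>
     boolean_hom A B \<eta> \<and> inj_on \<eta> A \<and> (\<forall>x\<in>A. \<eta> (\<alpha> x) = \<beta> (\<eta> x))"


section \<open>First-order logic of dynamical systems\<close>

datatype tm =
    Var nat
  | Zero
  | One
  | Join tm tm
  | Meet tm tm
  | Compl tm
  | Aut tm
  | AutInv tm

datatype fm =
    Eq tm tm
  | Le tm tm
  | Neg fm
  | And fm fm
  | Or fm fm
  | Imp fm fm
  | Exists nat fm
  | Forall nat fm

primrec tm_val ::
  "'a::boolean_algebra set \<Rightarrow> ('a \<Rightarrow> 'a) \<Rightarrow> (nat \<Rightarrow> 'a) \<Rightarrow> tm \<Rightarrow> 'a" where
  "tm_val A \<alpha> e (Var i) = e i"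
| "tm_val A \<alpha> e Zero = bot"
| "tm_val A \<alpha> e One = top"
| "tm_val A \<alpha> e (Join s t) = sup (tm_val A \<alpha> e s) (tm_val A \<alpha> e t)"
| "tm_val A \<alpha> e (Meet s t) = inf (tm_val A \<alpha> e s) (tm_val A \<alpha> e t)"
| "tm_val A \<alpha> e (Compl t) = - tm_val A \<alpha> e t"
| "tm_val A \<alpha> e (Aut t) = \<alpha> (tm_val A \<alpha> e t)"
| "tm_val A \<alpha> e (AutInv t) = inv_into A \<alpha> (tm_val A \<alpha> e t)"

primrec sat ::
  "'a::boolean_algebra set \<Rightarrow> ('a \<Rightarrow> 'a) \<Rightarrow> (nat \<Rightarrow> 'a) \<Rightarrow> fm \<Rightarrow> bool" where
  "sat A \<alpha> e (Eq s t) \<longleftrightarrow> tm_val A \<alpha> e s = tm_val A \<alpha> e t"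
| "sat A \<alpha> e (Le s t) \<longleftrightarrow> tm_val A \<alpha> e s \<le> tm_val A \<alpha> e t"
| "sat A \<alpha> e (Neg \<phi>) \<longleftrightarrow> \<not> sat A \<alpha> e \<phi>"
| "sat A \<alpha> e (And \<phi> \<psi>) \<longleftrightarrow> sat A \<alpha> e \<phi> \<and> sat A \<alpha> e \<psi>"
| "sat A \<alpha> e (Or \<phi> \<psi>) \<longleftrightarrow> sat A \<alpha> e \<phi> \<or> sat A \<alpha> e \<psi>"
| "sat A \<alpha> e (Imp \<phi> \<psi>) \<longleftrightarrow> (sat A \<alpha> e \<phi> \<longrightarrow> sat A \<alpha> e \<psi>)"
| "sat A \<alpha> e (Exists i \<phi>) \<longleftrightarrow> (\<exists>x\<in>A. sat A \<alpha> (e(i := x)) \<phi>)"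
| "sat A \<alpha> e (Forall i \<phi>) \<longleftrightarrow> (\<forall>x\<in>A. sat A \<alpha> (e(i := x)) \<phi>)"

text \<open>
  Parameters are supplied by assignments of elements of \<open>A\<close> to all variables; only the finitely
  many values at the free variables of the formula matter.
\<close>

definition elementary_embedding ::
  "'a::boolean_algebra set \<Rightarrow> ('a \<Rightarrow> 'a) \<Rightarrow> 'b::boolean_algebra set \<Rightarrow> ('b \<Rightarrow> 'b) \<Rightarrow> ('a \<Rightarrow> 'b) \<Rightarrow> bool"
  where
  "elementary_embedding A \<alpha> B \<beta> \<eta> \<longleftrightarrow> embedding A \<alpha> B \<beta> \<eta> \<and>
     (\<forall>\<phi> e. (\<forall>i. e i \<in> A) \<longrightarrow> (sat A \<alpha> e \<phi> \<longleftrightarrow> sat B \<beta> (\<lambda>i. \<eta> (e i)) \<phi>))"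

definition elementary_substructure ::
  "'a::boolean_algebra set \<Rightarrow> 'a set \<Rightarrow> ('a \<Rightarrow> 'a) \<Rightarrow> bool" where
  "elementary_substructure A B \<alpha> \<longleftrightarrow> A \<subseteq> B \<and> subalgebra A \<and>
     (\<forall>x\<in>A. \<alpha> x \<in> A \<and> inv_into B \<alpha> x \<in> A) \<and>
     elementary_embedding A \<alpha> B \<alpha> (\<lambda>x. x)"


section \<open>The systems in question are dynamical systems\<close>

lemma bij_shift: "bij shift"
proof (rule bijI)
  show "inj shift"
  proof (rule injI, transfer)
    fix A B :: "nat set" assume "eq_fin (Suc ` A) (Suc ` B)"
    then have "finite (Suc ` ((A - B) \<union> (B - A)))"
      by (simp add: eq_fin_def image_Un image_set_diff)
    then show "eq_fin A B"
      unfolding eq_fin_def by (rule finite_imageD) simp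
  qed
  show "surj shift"
  proof (rule surjI)
    show "shift (abs_pfin {n. Suc n \<in> rep_pfin a}) = a" for a
    proof -
      have "eq_fin (Suc ` {n. Suc n \<in> rep_pfin a}) (rep_pfin a)"
        unfolding eq_fin_def
        by (rule finite_subset[of _ "{0}"])
          (auto simp: image_iff, metis not0_implies_Suc)
      then have "abs_pfin (Suc ` {n. Suc n \<in> rep_pfin a}) = abs_pfin (rep_pfin a)"
        by (simp add: pfin.abs_eq_iff)
      then show ?thesis
        by (simp add: shift.abs_eq Quotient_abs_rep[OF Quotient_pfin])
    qed
  qed
qed

lemma range_Suc_compl: "- range Suc = {0}"
  by (auto simp: image_iff) (metis not0_implies_Suc)

lemma dynamical_system_shift: "dynamical_system UNIV shift"
proof -
  have "shift bot = bot" by transfer (simp add: eq_fin_def)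
  moreover have "shift top = top"
    by transfer (simp add: eq_fin_def Compl_eq_Diff_UNIV[symmetric] range_Suc_compl)
  moreover have "shift (- x) = - shift x" for x
  proof transfer
    fix A :: "nat set"
    have "Suc ` (- A) \<subseteq> - Suc ` A" "- Suc ` A - Suc ` (- A) \<subseteq> - range Suc" by auto
    then show "eq_fin (Suc ` (- A)) (- Suc ` A)"
      by (auto simp: eq_fin_def range_Suc_compl intro: finite_subset[of _ "{0}"])
  qed
  moreover have "shift (sup x y) = sup (shift x) (shift y)" for x y
    by transfer (simp add: eq_fin_def image_Un)
  moreover have "shift (inf x y) = inf (shift x) (shift y)" for x y
    by transfer (simp add: eq_fin_def image_Int)
  ultimately show ?thesis
    by (simp add: dynamical_system_def subalgebra_def boolean_hom_def bij_shift)
qed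

lemma elementary_substructure_dynamical_system:
  assumes "dynamical_system B \<alpha>" and "elementary_substructure A B \<alpha>"
  shows "dynamical_system A \<alpha>"
proof -
  have sub: "A \<subseteq> B" "subalgebra A" and cl: "\<And>x. x \<in> A \<Longrightarrow> \<alpha> x \<in> A \<and> inv_into B \<alpha> x \<in> A"
    using assms(2) by (auto simp: elementary_substructure_def)
  have hom: "boolean_hom B B \<alpha>" and bij: "bij_betw \<alpha> B B"
    using assms(1) by (auto simp: dynamical_system_def)
  have "boolean_hom A A \<alpha>"
    using hom sub cl by (auto simp: boolean_hom_def subset_iff)
  moreover have "inj_on \<alpha> A"
    using bij sub by (auto simp: bij_betw_def intro: inj_on_subset)
  moreover have "\<alpha> ` A = A"
  proof
    show "\<alpha> ` A \<subseteq> A" using cl by auto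
    show "A \<subseteq> \<alpha> ` A"
    proof
      fix x assume "x \<in> A"
      moreover from this have "\<alpha> (inv_into B \<alpha> x) = x"
        using bij sub by (auto simp: bij_betw_def f_inv_into_f)
      ultimately show "x \<in> \<alpha> ` A" using cl by (metis image_eqI)
    qed
  qed
  ultimately show ?thesis
    using sub by (simp add: dynamical_system_def bij_betw_def)
qed

end

theory Submission
  imports Defs "HOL-Library.Ramsey" "HOL-Library.Diagonal_Subsequence"
begin

text \<open>
  A finite tuple of \<open>\<P>(\<omega>)/Fin\<close> is a word \<open>\<omega> \<rightarrow> 2\<^sup>n\<close> up to finite changes, and its
  quantifier-free type says which finite patterns recur in the word. Call a countable subsystem
  rich if it realizes all finite types over its finite tuples that are realized in
  \<open>\<P>(\<omega>)/Fin\<close>; elementary substructures are rich. The main point is that for an embedding \<open>f\<close> of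
  a rich system \<open>A\<close>, the inverse of \<open>f\<close> extends to an embedding of any countable system
  \<open>C \<supseteq> f(A)\<close>; two such extensions in a row give a back-and-forth argument.

  For the extension one has to lift a word \<open>y\<close> enumerating \<open>A\<close> to a word with the same recurring
  edges as a word \<open>x\<close> enumerating \<open>C\<close>. By Ramsey's theorem \<open>y\<close> splits into blocks with a constant
  idempotent profile \<open>e\<close> of liftable walks. Blocks and running profiles form an automaton run,
  hence by richness they transfer to the side of \<open>x\<close>. There \<open>x\<close> itself is a lift, so \<open>e\<close> contains a
  closed walk through all recurring edges of \<open>x\<close>, and copies of this walk are glued over \<open>y\<close>.
\<close>

section \<open>Recurring edges of sequences of sets\<close>

definition edge :: "nat \<Rightarrow> (nat \<Rightarrow> nat set) \<Rightarrow> nat \<Rightarrow> nat set \<times> nat set" where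
  "edge n x t = (x t \<inter> {..<n}, x (Suc t) \<inter> {..<n})"

text \<open>Pairs of consecutive letters suffice because embeddings are read off from enumerations
  of systems closed under \<open>shift\<close>, where longer patterns show up as pairs in further
  coordinates.\<close>

definition recurring_edges :: "nat \<Rightarrow> (nat \<Rightarrow> nat set) \<Rightarrow> (nat set \<times> nat set) set" where
  "recurring_edges n x = {p. INFM t. edge n x t = p}"

lemma edge_in: "edge n x t \<in> Pow {..<n} \<times> Pow {..<n}"
  by (auto simp: edge_def)

lemma recurring_edges_subset: "recurring_edges n x \<subseteq> Pow {..<n} \<times> Pow {..<n}"
proof
  fix p assume "p \<in> recurring_edges n x"
  then obtain t where "edge n x t = p"
    by (auto simp: recurring_edges_def dest: INFM_EX)
  then show "p \<in> Pow {..<n} \<times> Pow {..<n}" using edge_in by metis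
qed

text \<open>There are finitely many possible edges of level \<open>n\<close>, so those that do not
  recur all disappear after some common position.\<close>

lemma MOST_edge_iff: "(MOST t. \<Phi> (edge n x t)) \<longleftrightarrow> (\<forall>p\<in>recurring_edges n x. \<Phi> p)"
proof
  assume M: "MOST t. \<Phi> (edge n x t)"
  show "\<forall>p\<in>recurring_edges n x. \<Phi> p"
  proof
    fix p assume "p \<in> recurring_edges n x"
    then have "INFM t. edge n x t = p" by (simp add: recurring_edges_def)
    then have "INFM t. edge n x t = p \<and> \<Phi> (edge n x t)" using M by (rule INFM_conjI)
    then show "\<Phi> p" by (auto dest: INFM_EX)
  qed
next
  assume R: "\<forall>p\<in>recurring_edges n x. \<Phi> p"
  define B where "B = Pow {..<n} \<times> Pow {..<n} - recurring_edges n x"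
  have "MOST t. \<forall>p\<in>B. edge n x t \<noteq> p"
    by (subst MOST_finite_Ball_distrib) (auto simp: B_def recurring_edges_def)
  then show "MOST t. \<Phi> (edge n x t)"
  proof (rule MOST_mono)
    fix t assume "\<forall>p\<in>B. edge n x t \<noteq> p"
    then have "edge n x t \<in> recurring_edges n x" using edge_in[of n x t] by (auto simp: B_def)
    then show "\<Phi> (edge n x t)" using R by blast
  qed
qed

lemma INFM_edge_iff: "(INFM t. \<Phi> (edge n x t)) \<longleftrightarrow> (\<exists>p\<in>recurring_edges n x. \<Phi> p)"
  using MOST_edge_iff[of "\<lambda>p. \<not> \<Phi> p" n x] by (simp flip: not_INFM) blast

definition trunc_edge :: "nat \<Rightarrow> nat set \<times> nat set \<Rightarrow> nat set \<times> nat set" where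
  "trunc_edge n = map_prod (\<lambda>u. u \<inter> {..<n}) (\<lambda>u. u \<inter> {..<n})"

lemma trunc_edge_edge: "m \<le> n \<Longrightarrow> trunc_edge m (edge n x t) = edge m x t"
  by (auto simp: trunc_edge_def edge_def)

text \<open>Pigeonhole: if an edge of level \<open>m\<close> recurs, so does one of its finitely
  many refinements of level \<open>n\<close>.\<close>

lemma recurring_edges_trunc:
  assumes "m \<le> n"
  shows "recurring_edges m x = trunc_edge m ` recurring_edges n x"
proof -
  have "p \<in> recurring_edges m x \<longleftrightarrow> (\<exists>q\<in>recurring_edges n x. trunc_edge m q = p)" for p
    using INFM_edge_iff[of "\<lambda>q. trunc_edge m q = p" n x] trunc_edge_edge[OF assms]
    by (simp add: recurring_edges_def)
  then show ?thesis unfolding set_eq_iff image_iff by (simp add: eq_commute)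
qed

section \<open>Profiles of finite words\<close>

type_synonym walk = "nat set \<times> nat set \<times> (nat set \<times> nat set) set"

text \<open>
  A word over the coordinates in \<open>I\<close> is lifted to a walk on the subsets of \<open>{..<n}\<close>. A triple
  \<open>(u, v, S)\<close> records the first vertex, the last vertex and the set of edges of such a walk, and a
  profile is the set of all triples of a given word.
\<close>

definition fiber :: "nat set \<Rightarrow> nat \<Rightarrow> nat set \<Rightarrow> nat set set" where
  "fiber I n l = {v. v \<subseteq> {..<n} \<and> v \<inter> I = l \<inter> {..<n}}"

definition init_profile :: "nat set \<Rightarrow> nat \<Rightarrow> nat set \<Rightarrow> walk set" where
  "init_profile I n l = {(u, u, {}) | u. u \<in> fiber I n l}"

definition step_profile :: "nat set \<Rightarrow> nat \<Rightarrow> nat set \<Rightarrow> walk set \<Rightarrow> walk set" where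
  "step_profile I n l Q =
     {(u, v', insert (v, v') S) | u v v' S. (u, v, S) \<in> Q \<and> v' \<in> fiber I n l}"

text \<open>Walks are joined at a shared vertex, which corresponds to words that overlap in one
  letter.\<close>

definition comp_profile :: "walk set \<Rightarrow> walk set \<Rightarrow> walk set" where
  "comp_profile Q R = {(u, w, S \<union> S') | u v w S S'. (u, v, S) \<in> Q \<and> (v, w, S') \<in> R}"

text \<open>\<open>profile I n w i k\<close> is the profile of the word \<open>w i, \<dots>, w (i + k)\<close>.\<close>

primrec profile :: "nat set \<Rightarrow> nat \<Rightarrow> (nat \<Rightarrow> nat set) \<Rightarrow> nat \<Rightarrow> nat \<Rightarrow> walk set" where
  "profile I n w i 0 = init_profile I n (w i)"
| "profile I n w i (Suc k) = step_profile I n (w (Suc (i + k))) (profile I n w i k)"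

lemma fiber_trunc: "fiber I n (l \<inter> {..<n}) = fiber I n l"
  by (simp add: fiber_def)

lemma init_profile_trunc: "init_profile I n (l \<inter> {..<n}) = init_profile I n l"
  by (simp add: init_profile_def fiber_trunc)

lemma step_profile_trunc: "step_profile I n (l \<inter> {..<n}) Q = step_profile I n l Q"
  by (simp add: step_profile_def fiber_trunc)

lemma mem_init_profile: "(u, v, T) \<in> init_profile I n l \<longleftrightarrow> u = v \<and> T = {} \<and> v \<in> fiber I n l"
  by (auto simp: init_profile_def)

lemma mem_step_profile:
  "(u, v', T) \<in> step_profile I n l Q \<longleftrightarrow>
     v' \<in> fiber I n l \<and> (\<exists>v S. (u, v, S) \<in> Q \<and> T = insert (v, v') S)"
  unfolding step_profile_def by blast

lemma mem_comp_profile: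
  "(u, w, T) \<in> comp_profile Q R \<longleftrightarrow>
     (\<exists>v S S'. (u, v, S) \<in> Q \<and> (v, w, S') \<in> R \<and> T = S \<union> S')"
  unfolding comp_profile_def by blast

lemma comp_profile_step:
  "comp_profile Q (step_profile I n l R) = step_profile I n l (comp_profile Q R)"
proof -
  have "(u, w, T) \<in> comp_profile Q (step_profile I n l R) \<longleftrightarrow>
      w \<in> fiber I n l \<and> (\<exists>v S v1 S1. (u, v, S) \<in> Q \<and> (v, v1, S1) \<in> R \<and> T = insert (v1, w) (S \<union> S1))"
    for u w T
    unfolding mem_comp_profile mem_step_profile by (metis Un_insert_right)
  moreover have "(u, w, T) \<in> step_profile I n l (comp_profile Q R) \<longleftrightarrow>
      w \<in> fiber I n l \<and> (\<exists>v S v1 S1. (u, v, S) \<in> Q \<and> (v, v1, S1) \<in> R \<and> T = insert (v1, w) (S \<union> S1))"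
    for u w T
    unfolding mem_comp_profile mem_step_profile by blast
  ultimately show ?thesis by (simp add: set_eq_iff)
qed

text \<open>One-letter profiles act as right units: a walk ending over \<open>l\<close> can only be
  joined with the trivial walk at its last vertex.\<close>

lemma comp_init_profile:
  assumes "\<And>u v S. (u, v, S) \<in> Q \<Longrightarrow> v \<in> fiber I n l"
  shows "comp_profile Q (init_profile I n l) = Q"
proof -
  have "(u, w, T) \<in> comp_profile Q (init_profile I n l) \<longleftrightarrow> (u, w, T) \<in> Q" for u w T
    unfolding mem_comp_profile mem_init_profile using assms by auto
  then show ?thesis by (simp add: set_eq_iff)
qed

lemma comp_step_init:
  "comp_profile (step_profile I n l Q) (init_profile I n l) = step_profile I n l Q"
  by (rule comp_init_profile) (simp add: mem_step_profile)

lemma profile_ends: "(u, v, S) \<in> profile I n w i k \<Longrightarrow> v \<in> fiber I n (w (i + k))"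
  by (cases k) (auto simp: mem_init_profile mem_step_profile)

lemma comp_profile_init:
  "comp_profile (profile I n w i k) (init_profile I n (w (i + k))) = profile I n w i k"
  by (rule comp_init_profile) (rule profile_ends)

lemma profile_add:
  "profile I n w i (k + l) = comp_profile (profile I n w i k) (profile I n w (i + k) l)"
proof (induction l)
  case 0
  show ?case using comp_profile_init by simp
next
  case (Suc l)
  then show ?case by (simp add: comp_profile_step add.assoc)
qed

text \<open>Recovers actual walks \<open>r\<close> from the recursion. Gluing, truncation and the
  search for loops work with these walks.\<close>

lemma profile_in_iff:
  "(u, v, S) \<in> profile I n w i k \<longleftrightarrow>
     (\<exists>r. r i = u \<and> r (i + k) = v \<and> S = (\<lambda>t. (r t, r (Suc t))) ` {i..<i+k} \<and>
        (\<forall>t\<in>{i..i+k}. r t \<in> fiber I n (w t)))"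
proof (induction k arbitrary: v S)
  case 0
  then show ?case 
    by (auto simp: mem_init_profile intro: exI[of _ "\<lambda>_. u"])
next
  case (Suc k)
  show ?case
  proof
    assume "(u, v, S) \<in> profile I n w i (Suc k)"
    then obtain v0 S0 where S: "S = insert (v0, v) S0" and v: "v \<in> fiber I n (w (Suc (i + k)))"
      and 0: "(u, v0, S0) \<in> profile I n w i k"
      unfolding profile.simps mem_step_profile by blast
    obtain r where r: "r i = u" "r (i + k) = v0" "S0 = (\<lambda>t. (r t, r (Suc t))) ` {i..<i+k}"
      "\<forall>t\<in>{i..i+k}. r t \<in> fiber I n (w t)" using Suc.IH[THEN iffD1, OF 0] by blast
    define r' where "r' = r(Suc (i + k) := v)"
    have "(\<lambda>t. (r' t, r' (Suc t))) ` {i..<i+k} = (\<lambda>t. (r t, r (Suc t))) ` {i..<i+k}"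
      by (rule image_cong) (auto simp: r'_def)
    moreover have "{i..<i + Suc k} = insert (i + k) {i..<i+k}" by auto
    ultimately have "S = (\<lambda>t. (r' t, r' (Suc t))) ` {i..<i + Suc k}"
      using S r by (simp add: r'_def)
    moreover have "r' i = u" "r' (i + Suc k) = v" "\<forall>t\<in>{i..i+Suc k}. r' t \<in> fiber I n (w t)"
      using r v by (auto simp: r'_def)
    ultimately show "\<exists>r. r i = u \<and> r (i + Suc k) = v \<and>
        S = (\<lambda>t. (r t, r (Suc t))) ` {i..<i+Suc k} \<and> (\<forall>t\<in>{i..i+Suc k}. r t \<in> fiber I n (w t))"
      by blast
  next
    assume "\<exists>r. r i = u \<and> r (i + Suc k) = v \<and>
        S = (\<lambda>t. (r t, r (Suc t))) ` {i..<i+Suc k} \<and> (\<forall>t\<in>{i..i+Suc k}. r t \<in> fiber I n (w t))"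
    then obtain r where r: "r i = u" "r (i + Suc k) = v"
        "S = (\<lambda>t. (r t, r (Suc t))) ` {i..<i+Suc k}" "\<forall>t\<in>{i..i+Suc k}. r t \<in> fiber I n (w t)"
      by blast
    have "(u, r (i + k), (\<lambda>t. (r t, r (Suc t))) ` {i..<i+k}) \<in> profile I n w i k"
      using Suc.IH[of "r (i + k)"] r(1,4) by auto
    moreover have "{i..<i + Suc k} = insert (i + k) {i..<i+k}" by auto
    then have "S = insert (r (i + k), v) ((\<lambda>t. (r t, r (Suc t))) ` {i..<i+k})"
      using r by simp
    ultimately show "(u, v, S) \<in> profile I n w i (Suc k)"
      using r(2,4) unfolding profile.simps mem_step_profile by auto
  qed
qed

lemma profile_subset:
  "profile I n w i k \<subseteq> Pow {..<n} \<times> Pow {..<n} \<times> Pow (Pow {..<n} \<times> Pow {..<n})"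
proof
  fix p assume p: "p \<in> profile I n w i k"
  obtain u v S where uvS: "p = (u, v, S)" by (cases p)
  have "(u, v, S) \<in> profile I n w i k" using p uvS by simp
  then obtain r where "r i = u" "r (i + k) = v" "S = (\<lambda>t. (r t, r (Suc t))) ` {i..<i+k}"
    and fib: "\<forall>t\<in>{i..i+k}. r t \<in> fiber I n (w t)"
    unfolding profile_in_iff by (elim exE conjE)
  then have p_eq: "p = (r i, r (i + k), (\<lambda>t. (r t, r (Suc t))) ` {i..<i+k})"
    using uvS by simp
  from fib have r: "r t \<in> Pow {..<n}" if "i \<le> t" "t \<le> i + k" for t
    using that by (simp add: fiber_def)
  have "(\<lambda>t. (r t, r (Suc t))) ` {i..<i+k} \<subseteq> Pow {..<n} \<times> Pow {..<n}"
    by (intro image_subsetI SigmaI r) auto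
  then show "p \<in> Pow {..<n} \<times> Pow {..<n} \<times> Pow (Pow {..<n} \<times> Pow {..<n})"
    unfolding p_eq by (intro SigmaI r PowI) auto
qed

text \<open>The set is uniform in words and positions. This makes profiles usable as colours for
  Ramsey's theorem and as states of a finite automaton.\<close>

lemma finite_profiles: "finite {profile I n w i k | w i k. True}"
proof (rule finite_subset)
  show "{profile I n w i k | w i k. True} \<subseteq> Pow (Pow {..<n} \<times> Pow {..<n} \<times> Pow (Pow {..<n} \<times> Pow {..<n}))"
    using profile_subset by blast
  show "finite (Pow (Pow {..<n} \<times> Pow {..<n} \<times> Pow (Pow {..<n} \<times> Pow {..<n})))" by simp
qed

section \<open>Diagonal and compactness arguments\<close>

lemma ramsey_sequence:
  fixes F :: "nat \<Rightarrow> nat \<Rightarrow> 'a"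
  assumes "finite {F i j | i j. True}"
  shows "\<exists>(r :: nat \<Rightarrow> nat) e. strict_mono r \<and> (\<forall>i j. i < j \<longrightarrow> F (r i) (r j) = e)"
proof -
  obtain h :: "'a \<Rightarrow> nat" and N where h: "h ` {F i j | i j. True} = {i. i < N}"
    "inj_on h {F i j | i j. True}"
    using finite_imp_inj_to_nat_seg[OF assms] by blast
  \<comment> \<open>Ramsey's theorem colours unordered pairs; \<open>Min\<close> and
    \<open>Max\<close> restore the order, and \<open>h\<close> codes colours by numbers below
    \<open>N\<close>.\<close>
  define f where "f X = h (F (Min X) (Max X))" for X
  have "f X < N" for X
  proof -
    have "f X \<in> h ` {F i j | i j. True}" unfolding f_def by blast
    then show ?thesis unfolding h(1) by simp
  qed
  then have "\<forall>a\<in>UNIV. \<forall>b\<in>UNIV. a \<noteq> b \<longrightarrow> f {a, b} < N" by simp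
  from Ramsey2[OF infinite_UNIV_nat this] obtain Y c where Y: "infinite Y"
    and "\<forall>a\<in>Y. \<forall>b\<in>Y. a \<noteq> b \<longrightarrow> f {a, b} = c" by (elim exE conjE)
  then have c: "f {a, b} = c" if "a \<in> Y" "b \<in> Y" "a \<noteq> b" for a b using that by simp
  obtain r :: "nat \<Rightarrow> nat" where r: "strict_mono r" "\<And>n. r n \<in> Y"
    using infinite_enumerate[OF Y] by blast
  have f_r: "h (F (r i) (r j)) = c" if "i < j" for i j
  proof -
    have less: "r i < r j" using r(1) that by (simp add: strict_monoD)
    then have "f {r i, r j} = c" using c[OF r(2) r(2), of i j] by simp
    moreover have "Min {r i, r j} = r i" "Max {r i, r j} = r j" using less by auto
    ultimately show ?thesis by (simp add: f_def)
  qed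
  define e where "e = F (r 0) (r 1)"
  have "F (r i) (r j) = e" if "i < j" for i j
    unfolding e_def
  proof (rule inj_onD[OF h(2)])
    show "h (F (r i) (r j)) = h (F (r 0) (r 1))" using f_r[OF that] f_r[of 0 1] by simp
  qed blast+
  then show ?thesis using r(1) by blast
qed

text \<open>Each level is made homogeneous by thinning out the previous subsequence. The diagonal
  sequence serves all levels at once, level \<open>n\<close> only from index \<open>n\<close>
  on.\<close>

lemma diagonal_profiles:
  "\<exists>(d :: nat \<Rightarrow> nat) e. strict_mono d \<and>
     (\<forall>n i j. n \<le> i \<longrightarrow> i < j \<longrightarrow> profile I n w (d i) (d j - d i) = e n)"
proof -
  define P where "P n s \<longleftrightarrow> (\<exists>e. \<forall>i j. i < j \<longrightarrow> profile I n w (s i) (s j - s i) = e)"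
    for n and s :: "nat \<Rightarrow> nat"
  interpret subseqs P
  proof
    fix n and s :: "nat \<Rightarrow> nat"
    have "finite {profile I n w (s i) (s j - s i) | i j. True}"
      by (rule finite_subset[OF _ finite_profiles]) blast
    from ramsey_sequence[OF this] obtain r :: "nat \<Rightarrow> nat" and e where "strict_mono r"
      and "\<forall>i j. i < j \<longrightarrow> profile I n w (s (r i)) (s (r j) - s (r i)) = e"
      by blast
    then show "\<exists>r'. strict_mono r' \<and> P n (s \<circ> r')"
      unfolding P_def o_def by blast
  qed
  have "P n (diagseq \<circ> (+) (Suc n))" for n
  proof (rule diagseq_holds)
    fix r s :: "nat \<Rightarrow> nat" and n
    assume "strict_mono r" "P n s"
    then show "P n (s \<circ> r)" unfolding P_def o_def by (meson strict_monoD)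
  qed
  then have "\<forall>n. \<exists>e. \<forall>i j. i < j \<longrightarrow>
      profile I n w (diagseq (Suc n + i)) (diagseq (Suc n + j) - diagseq (Suc n + i)) = e"
    by (simp add: P_def)
  then obtain e where e: "\<And>n i j. i < j \<Longrightarrow>
      profile I n w (diagseq (Suc n + i)) (diagseq (Suc n + j) - diagseq (Suc n + i)) = e n"
    by metis
  \<comment> \<open>The tail that is homogeneous for level \<open>n\<close> starts at
    \<open>Suc n\<close>; shifting the index by one makes it start at \<open>n\<close>.\<close>
  have "profile I n w (diagseq (Suc i)) (diagseq (Suc j) - diagseq (Suc i)) = e n"
    if "n \<le> i" "i < j" for n i j
    using e[of "i - n" "j - n" n] that by simp
  moreover have "strict_mono (\<lambda>i. diagseq (Suc i))"
    using subseq_diagseq by (simp add: strict_mono_def)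
  ultimately show ?thesis
    by (intro exI[of _ "\<lambda>i. diagseq (Suc i)"] exI[of _ e]) simp
qed

text \<open>Koenig's lemma for a tree ordered by truncation, whose levels are finite by
  \<open>sub\<close>.\<close>

lemma konig_subsets:
  fixes H :: "nat \<Rightarrow> nat set set"
  assumes nonempty: "\<And>n. H n \<noteq> {}"
    and sub: "\<And>n h. h \<in> H n \<Longrightarrow> h \<subseteq> {..<n}"
    and trunc: "\<And>m n h. m \<le> n \<Longrightarrow> h \<in> H n \<Longrightarrow> h \<inter> {..<m} \<in> H m"
  shows "\<exists>s. \<forall>n. s \<inter> {..<n} \<in> H n"
proof -
  have "\<forall>n. \<exists>h. h \<in> H n" using nonempty by blast
  then obtain g where g: "\<And>n. g n \<in> H n" by metis
  \<comment> \<open>Only nodes extended by infinitely many \<open>g N\<close> are kept; one of the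
    two one-step extensions of such a node is again of this kind.\<close>
  define P where "P n v \<longleftrightarrow> v \<subseteq> {..<n} \<and> (INFM N. g N \<inter> {..<n} = v)" for n v
  have "\<exists>f. \<forall>n. P n (f n) \<and> f (Suc n) \<inter> {..<n} = f n"
  proof (rule dependent_nat_choice)
    show "\<exists>v. P 0 v" by (simp add: P_def)
    fix v n assume v: "P n v"
    have "INFM N. \<exists>y\<in>Pow {..<Suc n}. y \<inter> {..<n} = v \<and> g N \<inter> {..<Suc n} = y"
      by (rule INFM_mono[of "\<lambda>N. g N \<inter> {..<n} = v"]) (use v in \<open>auto simp: P_def\<close>)
    then obtain y where "y \<in> Pow {..<Suc n}" "INFM N. y \<inter> {..<n} = v \<and> g N \<inter> {..<Suc n} = y"
      by (subst (asm) INFM_finite_Bex_distrib) auto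
    then show "\<exists>y. P (Suc n) y \<and> y \<inter> {..<n} = v"
      by (intro exI[of _ y]) (auto simp: P_def elim: INFM_mono dest: INFM_EX)
  qed
  then obtain f where P: "\<And>n. P n (f n)" and f: "\<And>n. f (Suc n) \<inter> {..<n} = f n" by blast
  have f_trunc: "f m \<inter> {..<n} = f n" if "n \<le> m" for m n
    using that
  proof (induction rule: dec_induct)
    case base
    then show ?case using P[of n] by (auto simp: P_def)
  next
    case (step m)
    have "{..<m} \<inter> {..<n} = {..<n}" using step.hyps by auto
    then have "f (Suc m) \<inter> {..<n} = (f (Suc m) \<inter> {..<m}) \<inter> {..<n}" by (simp add: Int_assoc)
    then show ?case using f[of m] step.IH by simp
  qed
  have "(\<Union>m. f m) \<inter> {..<n} = f n" for n
  proof
    show "(\<Union>m. f m) \<inter> {..<n} \<subseteq> f n"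
    proof
      fix k assume "k \<in> (\<Union>m. f m) \<inter> {..<n}"
      then obtain m where m: "k \<in> f m" "k < n" by auto
      show "k \<in> f n"
      proof (cases "n \<le> m")
        case True
        then show ?thesis using f_trunc[of n m] m by auto
      next
        case False
        then show ?thesis using f_trunc[of m n] m by auto
      qed
    qed
    show "f n \<subseteq> (\<Union>m. f m) \<inter> {..<n}" using P[of n] by (auto simp: P_def)
  qed
  moreover have "f n \<in> H n" for n
  proof -
    \<comment> \<open>Some late \<open>g N\<close> truncates to \<open>f n\<close>, and
      \<open>trunc\<close> keeps truncations inside the tree.\<close>
    have "INFM N. g N \<inter> {..<n} = f n" using P by (simp add: P_def)
    then obtain N where "n \<le> N" "g N \<inter> {..<n} = f n" by (auto simp: INFM_nat_le)
    then show ?thesis using trunc[OF _ g] by metis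
  qed
  ultimately show ?thesis by (intro exI[of _ "\<Union>m. f m"]) simp
qed

section \<open>Blocks of an increasing sequence\<close>

text \<open>For strictly increasing \<open>d\<close> this is the index of the block containing
  \<open>t\<close>; positions before \<open>d 0\<close> are assigned to block 0.\<close>

definition block :: "(nat \<Rightarrow> nat) \<Rightarrow> nat \<Rightarrow> nat" where
  "block d t = (LEAST n. t < d (Suc n))"

lemma block_eq:
  assumes "strict_mono d" "d n \<le> t" "t < d (Suc n)"
  shows "block d t = n"
  unfolding block_def
proof (rule Least_equality)
  show "t < d (Suc n)" by fact
next
  fix m assume "t < d (Suc m)"
  then have "d n < d (Suc m)" using assms(2) by simp
  then show "n \<le> m" using assms(1) by (simp add: strict_mono_less)
qed

lemma block_bounds:
  assumes d: "strict_mono d" and "d m \<le> t"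
  shows "d (block d t) \<le> t" "t < d (Suc (block d t))" "m \<le> block d t"
proof -
  have "t < d (Suc t)"
    using strict_mono_imp_increasing[OF d, of "Suc t"] by simp
  then show less: "t < d (Suc (block d t))" unfolding block_def by (rule LeastI[where P = "\<lambda>n. t < d (Suc n)"])
  show "d (block d t) \<le> t"
  proof (cases "block d t")
    case 0
    have "d 0 \<le> d m" using d by (simp add: strict_mono_less_eq)
    then show ?thesis using 0 assms(2) by simp
  next
    case (Suc k)
    then have "\<not> t < d (Suc k)" unfolding block_def by (metis lessI not_less_Least)
    then show ?thesis using Suc by simp
  qed
  have "d m < d (Suc (block d t))" using less assms(2) by simp
  then show "m \<le> block d t" using d by (simp add: strict_mono_less)
qed

text \<open>Block \<open>n\<close> carries a closed walk of level \<open>n\<close>, so ever finer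
  walks are glued. Their base points are truncations of the one set \<open>s\<close>, so junctions
  eventually create no new edges at any fixed level.\<close>

lemma glue_walks:
  fixes s :: "nat set"
  assumes d: "strict_mono d"
    and loops: "\<And>n. (s \<inter> {..<n}, s \<inter> {..<n}, recurring_edges n x)
                      \<in> profile I n y (d n) (d (Suc n) - d n)"
  shows "\<exists>z. (\<forall>n. recurring_edges n z = recurring_edges n x) \<and>
             (\<forall>i\<in>I. MOST t. i \<in> z t \<longleftrightarrow> i \<in> y t)"
proof -
  have d_Suc: "d n + (d (Suc n) - d n) = d (Suc n)" for n
    using d by (simp add: strict_mono_Suc_iff less_imp_le)
  define Q where "Q n r \<longleftrightarrow> r (d n) = s \<inter> {..<n} \<and> r (d (Suc n)) = s \<inter> {..<n} \<and>
      recurring_edges n x = (\<lambda>t. (r t, r (Suc t))) ` {d n..<d (Suc n)} \<and>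
      (\<forall>t\<in>{d n..d (Suc n)}. r t \<in> fiber I n (y t))" for n r
  have "\<exists>r. Q n r" for n
    using loops[of n] unfolding profile_in_iff d_Suc Q_def .
  then obtain r where r: "\<And>n. Q n (r n)" by metis
  have r_start: "r n (d n) = s \<inter> {..<n}" and r_end: "r n (d (Suc n)) = s \<inter> {..<n}"
    and r_edges: "recurring_edges n x = (\<lambda>t. (r n t, r n (Suc t))) ` {d n..<d (Suc n)}"
    for n using r[of n] unfolding Q_def by simp_all
  have r_fiber: "r n t \<in> fiber I n (y t)" if "t \<in> {d n..d (Suc n)}" for n t
    using r[of n] that unfolding Q_def by blast
  define z where "z t = r (block d t) t" for t
  have z_eq: "z t = r n t" if "d n \<le> t" "t < d (Suc n)" for n t
    using block_eq[OF d that] by (simp add: z_def)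
  have z_edge: "edge m z t = trunc_edge m (r n t, r n (Suc t))"
    if t: "d n \<le> t" "t < d (Suc n)" and "m \<le> n" for m n t
  proof (cases "Suc t < d (Suc n)")
    case True
    then show ?thesis using z_eq[of n t] z_eq[of n "Suc t"] t by (simp add: edge_def trunc_edge_def)
  next
    case False
    \<comment> \<open>At a junction the next letter belongs to the walk of level
      \<open>Suc n\<close>, whose first vertex agrees below \<open>n\<close> with the last vertex of
      the current walk.\<close>
    then have Suc_t: "Suc t = d (Suc n)" using t by simp
    have "d (Suc n) < d (Suc (Suc n))" using d by (simp add: strict_mono_less)
    then have "z (Suc t) = s \<inter> {..<Suc n}" using z_eq[of "Suc n" "Suc t"] Suc_t r_start by simp
    moreover have "r n (Suc t) = s \<inter> {..<n}" using Suc_t r_end by simp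
    moreover have "s \<inter> {..<Suc n} \<inter> {..<m} = s \<inter> {..<n} \<inter> {..<m}" using \<open>m \<le> n\<close> by auto
    ultimately show ?thesis using z_eq[OF t] by (simp add: edge_def trunc_edge_def)
  qed
  have "recurring_edges m z = recurring_edges m x" for m
  proof
    show "recurring_edges m z \<subseteq> recurring_edges m x"
    proof
      fix p assume "p \<in> recurring_edges m z"
      then have "INFM t. edge m z t = p" by (simp add: recurring_edges_def)
      then obtain t where t: "d m \<le> t" and p: "edge m z t = p" by (auto simp: INFM_nat_le)
      define n where "n = block d t"
      note b = block_bounds[OF d t, folded n_def]
      have "(r n t, r n (Suc t)) \<in> recurring_edges n x" using b r_edges by auto
      then have "trunc_edge m (r n t, r n (Suc t)) \<in> recurring_edges m x"
        using recurring_edges_trunc[OF b(3)] by blast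
      then show "p \<in> recurring_edges m x" using z_edge[OF b] p by simp
    qed
    show "recurring_edges m x \<subseteq> recurring_edges m z"
    proof
      fix p assume p: "p \<in> recurring_edges m x"
      have "\<exists>t\<ge>k. edge m z t = p" for k
      proof -
        \<comment> \<open>Block \<open>n\<close> lies past \<open>k\<close> and is fine enough for
          level \<open>m\<close>; its walk uses every recurring edge of \<open>x\<close>.\<close>
        define n where "n = max k m"
        have n: "m \<le> n" "k \<le> n" by (auto simp: n_def)
        obtain q where "q \<in> recurring_edges n x" "p = trunc_edge m q"
          using p recurring_edges_trunc[OF n(1)] by blast
        then obtain t where t: "d n \<le> t" "t < d (Suc n)" "p = trunc_edge m (r n t, r n (Suc t))"
          using r_edges[of n] by auto
        then have "edge m z t = p" using z_edge n by simp
        moreover have "k \<le> t" using t(1) n strict_mono_imp_increasing[OF d, of n] by simp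
        ultimately show ?thesis by blast
      qed
      then show "p \<in> recurring_edges m z" by (simp add: recurring_edges_def INFM_nat_le)
    qed
  qed
  moreover have "MOST t. i \<in> z t \<longleftrightarrow> i \<in> y t" if "i \<in> I" for i
  proof -
    \<comment> \<open>From \<open>d (Suc i)\<close> on the level of the block exceeds
      \<open>i\<close>, so the fiber condition controls coordinate \<open>i\<close>.\<close>
    have "i \<in> z t \<longleftrightarrow> i \<in> y t" if t: "d (Suc i) \<le> t" for t
    proof -
      note b = block_bounds[OF d t]
      have eq: "r (block d t) t \<inter> I = y t \<inter> {..<block d t}"
        using r_fiber[of t "block d t"] b by (simp add: fiber_def)
      have "i \<in> z t \<longleftrightarrow> i \<in> r (block d t) t \<inter> I" using \<open>i \<in> I\<close> by (simp add: z_def)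
      also have "\<dots> \<longleftrightarrow> i \<in> y t" unfolding eq using b(3) by simp
      finally show ?thesis .
    qed
    then show ?thesis unfolding MOST_nat_le by blast
  qed
  ultimately show ?thesis by blast
qed

section \<open>Transfer of profiles\<close>

text \<open>
  Every finitely coloured expansion of \<open>y\<close> has a counterpart over the coordinates in \<open>I\<close> of \<open>x\<close>
  with the same eventual local behaviour.
\<close>

definition transfers :: "nat set \<Rightarrow> (nat \<Rightarrow> nat set) \<Rightarrow> (nat \<Rightarrow> nat set) \<Rightarrow> 's itself \<Rightarrow> bool" where
  "transfers I x y _ \<longleftrightarrow> (\<forall>n (q :: nat \<Rightarrow> 's). finite (range q) \<longrightarrow>
     (\<exists>q'. \<forall>R. (MOST t. R (y t \<inter> {..<n}) (q t) (y (Suc t) \<inter> {..<n}) (q (Suc t))) \<longleftrightarrow>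
       (MOST t. R (x t \<inter> I \<inter> {..<n}) (q' t) (x (Suc t) \<inter> I \<inter> {..<n}) (q' (Suc t)))))"

text \<open>The automaton that reads a word and keeps its profile since the last marker.\<close>

definition marked_step ::
  "nat set \<Rightarrow> nat \<Rightarrow> walk set \<Rightarrow> nat set \<Rightarrow> bool \<times> walk set \<Rightarrow> bool \<times> walk set \<Rightarrow> bool" where
  "marked_step I n e l a b \<longleftrightarrow>
     (if fst b then step_profile I n l (snd a) = e \<and> snd b = init_profile I n l
      else snd b = step_profile I n l (snd a))"

text \<open>Hence a step is a local relation of the kind that \<open>transfers\<close>
  preserves.\<close>

lemma marked_step_trunc: "marked_step I n e (l \<inter> {..<n}) a b = marked_step I n e l a b"
  by (simp add: marked_step_def init_profile_trunc step_profile_trunc)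

lemma marked_profile:
  fixes d :: "nat \<Rightarrow> nat"
  assumes d: "strict_mono d"
    and e: "\<And>i j. i < j \<Longrightarrow> profile I n y (d i) (d j - d i) = e"
  shows "\<exists>q. finite (range q) \<and> (INFM t. fst (q t)) \<and>
             (MOST t. marked_step I n e (y (Suc t)) (q t) (q (Suc t)))"
proof -
  \<comment> \<open>A state is a marker, set at the points of \<open>d\<close>, together with the
    profile of the part of the current block read so far.\<close>
  define q where
    "q t = (t \<in> range d, profile I n y (d (block d t)) (t - d (block d t)))" for t
  have "range q \<subseteq> UNIV \<times> {profile I n w i k | w i k. True}" by (auto simp: q_def)
  then have "finite (range q)" 
    by (rule finite_subset) (intro finite_cartesian_product finite_profiles, simp)
  moreover have "INFM t. fst (q t)"
  proof -
    have "infinite (range d)" using d by (simp add: strict_mono_imp_inj_on range_inj_infinite)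
    then show ?thesis by (simp add: q_def frequently_cofinite)
  qed
  moreover have "marked_step I n e (y (Suc t)) (q t) (q (Suc t))" if "d 0 \<le> t" for t
  proof -
    define k where "k = block d t"
    have k: "d k \<le> t" "t < d (Suc k)" using block_bounds[OF d that] by (auto simp: k_def)
    have step: "step_profile I n (y (Suc t)) (profile I n y (d k) (t - d k))
        = profile I n y (d k) (Suc t - d k)"
      using k by (simp add: Suc_diff_le)
    show ?thesis
    proof (cases "Suc t < d (Suc k)")
      case True
      have "block d (Suc t) = k" using k True by (intro block_eq[OF d]) auto
      moreover have "Suc t \<notin> range d"
      proof
        assume "Suc t \<in> range d"
        then obtain j where "Suc t = d j" by blast
        then have "d k < d j" "d j < d (Suc k)" using k True by auto
        then have "k < j" "j < Suc k" using d by (simp_all add: strict_mono_less)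
        then show False by simp
      qed
      ultimately show ?thesis using step by (simp add: marked_step_def q_def k_def[symmetric])
    next
      case False
      then have Suc_t: "Suc t = d (Suc k)" using k by simp
      have "d (Suc k) < d (Suc (Suc k))" using d by (simp add: strict_mono_less)
      then have "block d (Suc t) = Suc k" using Suc_t by (intro block_eq[OF d]) auto
      then show ?thesis using step e[of k "Suc k"] Suc_t
        by (simp add: marked_step_def q_def k_def[symmetric])
    qed
  qed
  then have "MOST t. marked_step I n e (y (Suc t)) (q t) (q (Suc t))"
    unfolding MOST_nat_le by blast
  ultimately show ?thesis by blast
qed

text \<open>Every block between successive markers has profile \<open>e\<close>, and idempotence
  makes any positive number of them compose to \<open>e\<close>.\<close>

lemma marked_run:
  assumes idem: "comp_profile e e = e"
    and run: "\<And>t. i \<le> Suc t \<Longrightarrow> marked_step I n e (w (Suc t)) (q t) (q (Suc t))"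
    and start: "0 < i" "fst (q i)"
  shows "0 < k \<Longrightarrow> fst (q (i + k)) \<Longrightarrow> profile I n w i k = e"
proof -
  \<comment> \<open>The stored profile starts at the latest marker. Either this marker is
    \<open>i\<close>, or the completed blocks since \<open>i\<close> contribute one factor
    \<open>e\<close>.\<close>
  have "(profile I n w i k = snd (q (i + k)) \<or> profile I n w i k = comp_profile e (snd (q (i + k)))) \<and>
      (0 < k \<longrightarrow> fst (q (i + k)) \<longrightarrow> profile I n w i k = e)"
  proof (induction k)
    case 0
    \<comment> \<open>The reset at a marker is imposed by the step into it, so \<open>i\<close> must
      have a predecessor.\<close>
    obtain t where "i = Suc t" using start(1) by (cases i) auto
    then have "snd (q i) = init_profile I n (w i)"
      using run[of t] start(2) by (simp add: marked_step_def)
    then show ?case by simp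
  next
    case (Suc k)
    let ?l = "w (Suc (i + k))" and ?p = "snd (q (i + k))"
    have m: "marked_step I n e ?l (q (i + k)) (q (Suc (i + k)))" by (rule run) simp
    have P: "profile I n w i (Suc k) = step_profile I n ?l ?p \<or>
        profile I n w i (Suc k) = comp_profile e (step_profile I n ?l ?p)"
      using Suc.IH by (auto simp: comp_profile_step)
    show ?case
    proof (cases "fst (q (Suc (i + k)))")
      case True
      then have e: "step_profile I n ?l ?p = e"
        and init: "snd (q (Suc (i + k))) = init_profile I n ?l"
        using m by (auto simp: marked_step_def)
      have "profile I n w i (Suc k) = e" using P e idem by metis
      \<comment> \<open>The profile stored after the reset is a unit for \<open>e\<close>, because
        the walks in \<open>e\<close> end over the same letter.\<close>
      moreover have "comp_profile e (init_profile I n ?l) = e"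
        using comp_step_init[of I n ?l ?p] e by simp
      ultimately show ?thesis using init by simp
    next
      case False
      then have "snd (q (Suc (i + k))) = step_profile I n ?l ?p"
        using m by (simp add: marked_step_def)
      then show ?thesis using P False by simp
    qed
  qed
  then show "0 < k \<Longrightarrow> fst (q (i + k)) \<Longrightarrow> profile I n w i k = e" by blast
qed

text \<open>The word \<open>x\<close> lifts its own restriction to \<open>I\<close>. Between two
  distant marked positions with the same vertex it is a closed walk through all recurring edges, and
  the profile there is \<open>e\<close>.\<close>

lemma recurring_loop:
  assumes "INFM t. fst (q t)"
    and run: "MOST t. marked_step I n e (x (Suc t) \<inter> I) (q t) (q (Suc t))"
    and idem: "comp_profile e e = e"
  shows "\<exists>h. (h, h, recurring_edges n x) \<in> e"
proof -
  \<comment> \<open>Pigeonhole: some vertex occurs at infinitely many marked positions.\<close>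
  have "INFM t. \<exists>h\<in>Pow {..<n}. fst (q t) \<and> x t \<inter> {..<n} = h"
    using assms(1) by (rule INFM_mono) auto
  then obtain h where h: "INFM t. fst (q t) \<and> x t \<inter> {..<n} = h"
    by (subst (asm) INFM_finite_Bex_distrib) auto
  have "MOST t. edge n x t \<in> recurring_edges n x"
    using MOST_edge_iff[of "\<lambda>p. p \<in> recurring_edges n x" n x] by simp
  with run have "MOST t. marked_step I n e (x (Suc t) \<inter> I) (q t) (q (Suc t)) \<and>
      edge n x t \<in> recurring_edges n x" by (rule MOST_conjI)
  then obtain T where T: "\<And>t. T \<le> t \<Longrightarrow> marked_step I n e (x (Suc t) \<inter> I) (q t) (q (Suc t))"
    "\<And>t. T \<le> t \<Longrightarrow> edge n x t \<in> recurring_edges n x"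
    by (auto simp: MOST_nat_le)
  obtain i where i: "Suc T \<le> i" "fst (q i)" "x i \<inter> {..<n} = h"
    using h unfolding INFM_nat_le by blast
  have "\<exists>t\<ge>i. edge n x t = p" if "p \<in> recurring_edges n x" for p
    using that by (simp add: recurring_edges_def INFM_nat_le)
  \<comment> \<open>\<open>\<tau>\<close> selects an occurrence past \<open>i\<close> of each
    recurring edge; \<open>j\<close> is then placed beyond all of them.\<close>
  then obtain \<tau> where \<tau>: "\<And>p. p \<in> recurring_edges n x \<Longrightarrow> i \<le> \<tau> p \<and> edge n x (\<tau> p) = p"
    by metis
  have "finite (recurring_edges n x)" by (rule finite_subset[OF recurring_edges_subset]) simp
  then have "finite (\<tau> ` recurring_edges n x)" by simp
  then obtain B where B: "\<And>p. p \<in> recurring_edges n x \<Longrightarrow> \<tau> p < B"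
    unfolding finite_nat_set_iff_bounded by blast
  obtain j where j: "max B (Suc i) \<le> j" "fst (q j)" "x j \<inter> {..<n} = h"
    using h unfolding INFM_nat_le by blast
  have "profile I n (\<lambda>t. x t \<inter> I) i (j - i) = e"
  proof (rule marked_run[where q = q])
    show "marked_step I n e (x (Suc t) \<inter> I) (q t) (q (Suc t))" if "i \<le> Suc t" for t
      using T(1)[of t] i(1) that by simp
  qed (use idem i j in auto)
  moreover have "(h, h, recurring_edges n x) \<in> profile I n (\<lambda>t. x t \<inter> I) i (j - i)"
    unfolding profile_in_iff
  proof (intro exI conjI ballI)
    let ?r = "\<lambda>t. x t \<inter> {..<n}"
    show "?r i = h" by fact
    show "?r (i + (j - i)) = h" using j by simp
    show "recurring_edges n x = (\<lambda>t. (?r t, ?r (Suc t))) ` {i..<i + (j - i)}"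
    proof -
      have "recurring_edges n x = edge n x ` {i..<j}"
      proof
        show "recurring_edges n x \<subseteq> edge n x ` {i..<j}"
        proof
          fix p assume p: "p \<in> recurring_edges n x"
          show "p \<in> edge n x ` {i..<j}"
            using \<tau>[OF p] B[OF p] j(1) by (intro image_eqI[of _ _ "\<tau> p"]) auto
        qed
        show "edge n x ` {i..<j} \<subseteq> recurring_edges n x" using T(2) i(1) by auto
      qed
      moreover have "i + (j - i) = j" using j by simp
      ultimately show ?thesis by (simp add: edge_def)
    qed
    show "?r t \<in> fiber I n (x t \<inter> I)" for t by (auto simp: fiber_def)
  qed
  ultimately show ?thesis by auto
qed

text \<open>The marked run over \<open>y\<close> has finitely many states, so it has a counterpart
  over \<open>x\<close>, where the loop is visible.\<close>

lemma transfer_loop: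
  fixes d :: "nat \<Rightarrow> nat"
  assumes "transfers I x y TYPE(bool \<times> walk set)"
    and d: "strict_mono d"
    and e: "\<And>i j. i < j \<Longrightarrow> profile I n y (d i) (d j - d i) = e"
  shows "\<exists>h. (h, h, recurring_edges n x) \<in> e"
proof -
  obtain q where q: "finite (range q)" "INFM t. fst (q t)"
    "MOST t. marked_step I n e (y (Suc t)) (q t) (q (Suc t))"
    using marked_profile[OF d e] by blast
  obtain q' where q': "\<And>R. (MOST t. R (y t \<inter> {..<n}) (q t) (y (Suc t) \<inter> {..<n}) (q (Suc t))) \<longleftrightarrow>
       (MOST t. R (x t \<inter> I \<inter> {..<n}) (q' t) (x (Suc t) \<inter> I \<inter> {..<n}) (q' (Suc t)))"
    using assms(1) q(1) unfolding transfers_def by blast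
  have "INFM t. fst (q' t)"
    \<comment> \<open>Recurrence of markers is the negation of an eventual local condition, so it
      transfers as well.\<close>
    using q(2) q'[of "\<lambda>_ a _ _. \<not> fst a"] by (simp flip: not_MOST not_INFM)
  moreover have "MOST t. marked_step I n e (x (Suc t) \<inter> I) (q' t) (q' (Suc t))"
    using q(3) q'[of "\<lambda>_ a l b. marked_step I n e l a b"] by (simp add: marked_step_trunc)
  \<comment> \<open>Two adjacent blocks together again form a segment between points of
    \<open>d\<close>.\<close>
  moreover have "comp_profile e e = e"
  proof -
    have less: "d 0 < d 1" "d 1 < d 2" using d by (simp_all add: strict_mono_less)
    have "profile I n y (d 0) ((d 1 - d 0) + (d 2 - d 1)) = comp_profile e e"
      unfolding profile_add using e[of 0 1] e[of 1 2] less by simp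
    moreover have "(d 1 - d 0) + (d 2 - d 1) = d 2 - d 0" using less by simp
    ultimately show ?thesis using e[of 0 2] by simp
  qed
  ultimately show ?thesis by (rule recurring_loop)
qed

text \<open>Loops exist at every level by \<open>transfer_loop\<close>; Koenig's lemma makes their
  base points coherent, and the loops are then glued along the blocks of \<open>d\<close>.\<close>

lemma lift_sequence:
  assumes tr: "transfers I x y TYPE(bool \<times> walk set)"
  shows "\<exists>z. (\<forall>n. recurring_edges n z = recurring_edges n x) \<and>
             (\<forall>i\<in>I. MOST t. i \<in> z t \<longleftrightarrow> i \<in> y t)"
proof -
  obtain d :: "nat \<Rightarrow> nat" and e where d: "strict_mono d"
    and e: "\<And>n i j. n \<le> i \<Longrightarrow> i < j \<Longrightarrow> profile I n y (d i) (d j - d i) = e n"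
    using diagonal_profiles[of I y] by blast
  define H where "H n = {h. (h, h, recurring_edges n x) \<in> e n}" for n
  have e_Suc: "e n = profile I n y (d n) (d (Suc n) - d n)" for n using e[of n n "Suc n"] by simp
  have "\<exists>s. \<forall>n. s \<inter> {..<n} \<in> H n"
  proof (rule konig_subsets)
    fix n
    \<comment> \<open>Level \<open>n\<close> is homogeneous only from index \<open>n\<close> on,
      hence the passage to a tail of \<open>d\<close>.\<close>
    have "strict_mono (\<lambda>i. d (n + i))" using d by (simp add: strict_mono_def)
    from transfer_loop[OF tr this, of n "e n"] show "H n \<noteq> {}"
      using e by (auto simp: H_def)
  next
    fix n h assume "h \<in> H n"
    then show "h \<subseteq> {..<n}" using profile_subset[of I n y "d n" "d (Suc n) - d n"]
      by (auto simp: H_def e_Suc)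
  next
    fix m n h assume mn: "m \<le> n" and "h \<in> H n"
    have less: "d n < d (Suc n)" using d by (simp add: strict_mono_less)
    \<comment> \<open>As \<open>m \<le> n\<close>, \<open>e m\<close> can be computed on the block
      that defines \<open>e n\<close>, so truncating a walk of level \<open>n\<close> is
      enough.\<close>
    have em: "e m = profile I m y (d n) (d (Suc n) - d n)" using e[of m n "Suc n"] mn by simp
    have "(h, h, recurring_edges n x) \<in> profile I n y (d n) (d (Suc n) - d n)"
      using \<open>h \<in> H n\<close> by (simp add: H_def e_Suc)
    then obtain r where r: "r (d n) = h" "r (d n + (d (Suc n) - d n)) = h"
      "recurring_edges n x = (\<lambda>t. (r t, r (Suc t))) ` {d n..<d n + (d (Suc n) - d n)}"
      "\<forall>t\<in>{d n..d n + (d (Suc n) - d n)}. r t \<in> fiber I n (y t)"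
      unfolding profile_in_iff by blast
    have "(h \<inter> {..<m}, h \<inter> {..<m}, recurring_edges m x) \<in> profile I m y (d n) (d (Suc n) - d n)"
      unfolding profile_in_iff
    proof (intro exI conjI ballI)
      let ?r = "\<lambda>t. r t \<inter> {..<m}"
      show "?r (d n) = h \<inter> {..<m}" "?r (d n + (d (Suc n) - d n)) = h \<inter> {..<m}" using r by simp_all
      show "recurring_edges m x = (\<lambda>t. (?r t, ?r (Suc t))) ` {d n..<d n + (d (Suc n) - d n)}"
        unfolding recurring_edges_trunc[OF mn] r(3) image_image by (simp add: trunc_edge_def)
      fix t assume "t \<in> {d n..d n + (d (Suc n) - d n)}"
      then have "r t \<in> fiber I n (y t)" using r(4) by blast
      then have "r t \<inter> I = y t \<inter> {..<n}" by (simp add: fiber_def)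
      then have "r t \<inter> {..<m} \<inter> I = y t \<inter> ({..<n} \<inter> {..<m})" by (metis Int_assoc Int_commute)
      moreover have "{..<n} \<inter> {..<m} = {..<m}" using mn by auto
      ultimately show "?r t \<in> fiber I m (y t)" by (simp add: fiber_def)
    qed
    then show "h \<inter> {..<m} \<in> H m" by (simp add: H_def em)
  qed
  then obtain s where s: "\<And>n. s \<inter> {..<n} \<in> H n" by blast
  show ?thesis
    by (rule glue_walks[OF d, of s]) (use s in \<open>simp add: H_def e_Suc\<close>)
qed

section \<open>Sequences of elements of the algebra\<close>

text \<open>The choice of representatives affects finitely many coordinates at only finitely many
  positions, so it is invisible to \<open>recurring_edges\<close>.\<close>

definition seq_of :: "(nat \<Rightarrow> pfin) \<Rightarrow> nat \<Rightarrow> nat set" where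
  "seq_of c t = {i. t \<in> rep_pfin (c i)}"

lemma pfin_eq_iff: "a = b \<longleftrightarrow> (MOST t. t \<in> rep_pfin a \<longleftrightarrow> t \<in> rep_pfin b)"
proof -
  have "a = b \<longleftrightarrow> eq_fin (rep_pfin a) (rep_pfin b)"
    using Quotient_rel_rep[OF Quotient_pfin] by simp
  moreover have "(rep_pfin a - rep_pfin b) \<union> (rep_pfin b - rep_pfin a)
      = {t. \<not> (t \<in> rep_pfin a \<longleftrightarrow> t \<in> rep_pfin b)}" by blast
  ultimately show ?thesis by (simp add: eq_fin_def MOST_iff_cofinite)
qed

lemma MOST_rep_abs: "MOST t. t \<in> rep_pfin (abs_pfin A) \<longleftrightarrow> t \<in> A"
proof -
  have "eq_fin (rep_pfin (abs_pfin A)) A"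
    using Quotient_abs_rep[OF Quotient_pfin, of "abs_pfin A"] by (simp add: pfin.abs_eq_iff)
  moreover have "(rep_pfin (abs_pfin A) - A) \<union> (A - rep_pfin (abs_pfin A))
      = {t. \<not> (t \<in> rep_pfin (abs_pfin A) \<longleftrightarrow> t \<in> A)}" by blast
  ultimately show ?thesis by (simp add: eq_fin_def MOST_iff_cofinite)
qed

lemma abs_rep_pfin: "abs_pfin (rep_pfin a) = a"
  by (rule Quotient_abs_rep[OF Quotient_pfin])

lemma MOST_rep_bot: "MOST t. t \<notin> rep_pfin bot"
  using MOST_rep_abs[of "{}"] by (simp add: bot_pfin.abs_eq)

lemma MOST_rep_top: "MOST t. t \<in> rep_pfin top"
  using MOST_rep_abs[of UNIV] by (simp add: top_pfin.abs_eq)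

lemma MOST_rep_sup: "MOST t. t \<in> rep_pfin (sup a b) \<longleftrightarrow> t \<in> rep_pfin a \<or> t \<in> rep_pfin b"
  using MOST_rep_abs[of "rep_pfin a \<union> rep_pfin b"]
  by (simp add: sup_pfin.abs_eq[symmetric] abs_rep_pfin)

lemma MOST_rep_inf: "MOST t. t \<in> rep_pfin (inf a b) \<longleftrightarrow> t \<in> rep_pfin a \<and> t \<in> rep_pfin b"
  using MOST_rep_abs[of "rep_pfin a \<inter> rep_pfin b"]
  by (simp add: inf_pfin.abs_eq[symmetric] abs_rep_pfin)

lemma MOST_rep_uminus: "MOST t. t \<in> rep_pfin (- a) \<longleftrightarrow> t \<notin> rep_pfin a"
  using MOST_rep_abs[of "- rep_pfin a"]
  by (simp add: uminus_pfin.abs_eq[symmetric] abs_rep_pfin)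

lemma MOST_rep_shift: "MOST t. Suc t \<in> rep_pfin (shift a) \<longleftrightarrow> t \<in> rep_pfin a"
  using MOST_SucI[OF MOST_rep_abs[of "Suc ` rep_pfin a"]]
  by (simp add: shift.abs_eq[symmetric] abs_rep_pfin inj_image_mem_iff)

lemma MOST_cong: "MOST t. P t \<longleftrightarrow> Q t \<Longrightarrow> (MOST t. P t) \<longleftrightarrow> (MOST t. Q t)"
  by (rule eventually_subst)

lemma INFM_cong: "MOST t. P t \<longleftrightarrow> Q t \<Longrightarrow> (INFM t. P t) \<longleftrightarrow> (INFM t. Q t)"
  using MOST_cong[of "\<lambda>t. \<not> P t" "\<lambda>t. \<not> Q t"] by (simp flip: not_MOST not_INFM)

lemma recurring_edges_cong:
  assumes "\<And>i. i < n \<Longrightarrow> MOST t. i \<in> x t \<longleftrightarrow> i \<in> y t"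
  shows "recurring_edges n x = recurring_edges n y"
proof -
  have "MOST t. \<forall>i\<in>{..<n}. i \<in> x t \<longleftrightarrow> i \<in> y t"
    by (subst MOST_finite_Ball_distrib) (auto simp: assms)
  then have *: "MOST t. x t \<inter> {..<n} = y t \<inter> {..<n}" by (rule MOST_mono) blast
  from MOST_conjI[OF * MOST_SucI[OF *]] have "MOST t. edge n x t = edge n y t"
    by (rule MOST_mono) (simp add: edge_def)
  then have "MOST t. (edge n x t = p) \<longleftrightarrow> (edge n y t = p)" for p by (rule MOST_mono) simp
  from INFM_cong[OF this] show ?thesis by (simp add: recurring_edges_def)
qed

section \<open>Recurring edges in the first-order language\<close>

primrec cyl_tm :: "nat set \<Rightarrow> nat \<Rightarrow> tm" where
  "cyl_tm u 0 = One"
| "cyl_tm u (Suc n) = Meet (cyl_tm u n) (if n \<in> u then Var n else Compl (Var n))"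

text \<open>\<open>Aut\<close> moves the cylinder of the first vertex one position forward, so the
  meet collects the second ends of the occurrences of \<open>p\<close>. Being nonzero means that
  there are infinitely many.\<close>

definition edge_fm :: "nat \<Rightarrow> nat set \<times> nat set \<Rightarrow> fm" where
  "edge_fm n p = Neg (Eq (Meet (Aut (cyl_tm (fst p) n)) (cyl_tm (snd p) n)) Zero)"

lemma MOST_rep_cyl_tm:
  "MOST t. t \<in> rep_pfin (tm_val A shift c (cyl_tm u n)) \<longleftrightarrow> seq_of c t \<inter> {..<n} = u \<inter> {..<n}"
proof (induction n)
  case 0
  show ?case using MOST_rep_top by simp
next
  case (Suc n)
  let ?l = "if n \<in> u then Var n else Compl (Var n)"
  have "MOST t. t \<in> rep_pfin (tm_val A shift c ?l) \<longleftrightarrow> (n \<in> seq_of c t \<longleftrightarrow> n \<in> u)"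
    using MOST_rep_uminus[of "c n"] by (auto simp: seq_of_def)
  from MOST_conjI[OF Suc MOST_conjI[OF this
      MOST_rep_inf[of "tm_val A shift c (cyl_tm u n)" "tm_val A shift c ?l"]]]
  show ?case
    by (rule MOST_mono) (simp del: tm_val.simps(2-) add: lessThan_Suc tm_val.simps(5), blast)
qed

text \<open>The formula has neither quantifiers nor \<open>AutInv\<close>, so it means the same for
  every carrier \<open>A\<close>.\<close>

lemma sat_edge_fm:
  assumes "p \<in> Pow {..<n} \<times> Pow {..<n}"
  shows "sat A shift c (edge_fm n p) \<longleftrightarrow> p \<in> recurring_edges n (seq_of c)"
proof -
  obtain u v where p: "p = (u, v)" "u \<inter> {..<n} = u" "v \<inter> {..<n} = v" using assms by auto
  let ?X = "tm_val A shift c (cyl_tm u n)" and ?Y = "tm_val A shift c (cyl_tm v n)"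
  have "MOST t. Suc t \<in> rep_pfin (inf (shift ?X) ?Y) \<longleftrightarrow> edge n (seq_of c) t = p"
    using MOST_conjI[OF MOST_SucI[OF MOST_rep_inf[of "shift ?X" ?Y]]
        MOST_conjI[OF MOST_rep_shift[of ?X]
        MOST_conjI[OF MOST_rep_cyl_tm[of A c u n] MOST_SucI[OF MOST_rep_cyl_tm[of A c v n]]]]]
    by (rule MOST_mono) (simp add: edge_def p)
  from INFM_cong[OF this] have "(INFM t. Suc t \<in> rep_pfin (inf (shift ?X) ?Y)) \<longleftrightarrow>
      p \<in> recurring_edges n (seq_of c)" by (simp add: recurring_edges_def)
  moreover have "inf (shift ?X) ?Y = bot \<longleftrightarrow> (MOST t. t \<notin> rep_pfin (inf (shift ?X) ?Y))"
    unfolding pfin_eq_iff[of _ bot]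
    by (rule MOST_cong, rule MOST_mono[OF MOST_rep_bot]) simp
  moreover have "\<dots> \<longleftrightarrow> (MOST t. Suc t \<notin> rep_pfin (inf (shift ?X) ?Y))"
    by (rule MOST_Suc_iff[symmetric])
  ultimately show ?thesis by (simp add: edge_fm_def p flip: not_INFM)
qed

section \<open>Embeddings and recurring edges\<close>

definition closed_system :: "pfin set \<Rightarrow> bool" where
  "closed_system A \<longleftrightarrow> subalgebra A \<and> (\<forall>x\<in>A. shift x \<in> A \<and> inv_into UNIV shift x \<in> A)"

lemma tm_val_closed:
  "closed_system A \<Longrightarrow> (\<And>i. e i \<in> A) \<Longrightarrow> tm_val UNIV shift e t \<in> A"
  by (induction t) (auto simp: closed_system_def subalgebra_def)

lemma tm_val_embedding:
  assumes A: "closed_system A" and f: "embedding A shift UNIV shift f" and e: "\<And>i. e i \<in> A"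
  shows "tm_val UNIV shift (\<lambda>i. f (e i)) t = f (tm_val UNIV shift e t)"
proof (induction t)
  \<comment> \<open>Embeddings are only required to commute with \<open>shift\<close>; the inverse
    is treated by applying the injective \<open>shift\<close> to both sides.\<close>
  case (AutInv t)
  let ?x = "tm_val UNIV shift e t"
  have "inv_into UNIV shift ?x \<in> A"
    using A tm_val_closed[OF A e] by (simp add: closed_system_def)
  then have "shift (f (inv_into UNIV shift ?x)) = f (shift (inv_into UNIV shift ?x))"
    using f by (simp add: embedding_def)
  also have "\<dots> = f ?x" using bij_shift by (simp add: bij_is_surj surj_f_inv_f)
  finally have "inv_into UNIV shift (f ?x) = f (inv_into UNIV shift ?x)"
    using bij_shift by (intro inv_f_eq) (simp_all add: bij_is_inj)
  then show ?case using AutInv by simp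
qed (use f tm_val_closed[OF A e] in \<open>auto simp: embedding_def boolean_hom_def\<close>)

lemma embedding_le_iff:
  assumes A: "subalgebra A" and f: "embedding A \<alpha> B \<beta> f" and "x \<in> A" "y \<in> A"
  shows "f x \<le> f y \<longleftrightarrow> x \<le> y"
proof -
  have "f (inf x y) = inf (f x) (f y)" "inf x y \<in> A" "inj_on f A"
    using assms by (auto simp: subalgebra_def embedding_def boolean_hom_def)
  then show ?thesis
    using assms(3) by (metis inf.absorb_iff1 inj_on_eq_iff)
qed

text \<open>Each edge formula is a negated equation between terms, and injective homomorphisms
  preserve and reflect equations.\<close>

lemma embedding_recurring_edges:
  assumes A: "closed_system A" and f: "embedding A shift UNIV shift f" and e: "\<And>i. e i \<in> A"
  shows "recurring_edges n (seq_of (\<lambda>i. f (e i))) = recurring_edges n (seq_of e)"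
proof -
  have "sat UNIV shift (\<lambda>i. f (e i)) (Eq s t) \<longleftrightarrow> sat UNIV shift e (Eq s t)" for s t
    using f tm_val_closed[OF A e] unfolding sat.simps tm_val_embedding[OF assms]
    by (auto simp: embedding_def inj_on_eq_iff)
  then have "sat UNIV shift (\<lambda>i. f (e i)) (edge_fm n p) \<longleftrightarrow> sat UNIV shift e (edge_fm n p)" for p
    by (simp only: edge_fm_def sat.simps(3))
  then have "p \<in> recurring_edges n (seq_of (\<lambda>i. f (e i))) \<longleftrightarrow> p \<in> recurring_edges n (seq_of e)"
    if "p \<in> Pow {..<n} \<times> Pow {..<n}" for p
    using sat_edge_fm[OF that] by blast
  then show ?thesis using recurring_edges_subset by blast
qed

text \<open>Each relation says that almost all edges satisfy a local condition, and by
  \<open>MOST_edge_iff\<close> this depends on the recurring edges only.\<close>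

lemma same_edges_operations:
  assumes "\<And>n. recurring_edges n (seq_of c) = recurring_edges n (seq_of c')"
  shows "c i = c j \<longleftrightarrow> c' i = c' j"
    and "c i = bot \<longleftrightarrow> c' i = bot"
    and "c i = top \<longleftrightarrow> c' i = top"
    and "c k = - c i \<longleftrightarrow> c' k = - c' i"
    and "c k = sup (c i) (c j) \<longleftrightarrow> c' k = sup (c' i) (c' j)"
    and "c k = inf (c i) (c j) \<longleftrightarrow> c' k = inf (c' i) (c' j)"
    and "c k = shift (c i) \<longleftrightarrow> c' k = shift (c' i)"
proof -
  define n where "n = Suc (max i (max j k))"
  have n: "i < n" "j < n" "k < n" by (auto simp: n_def)
  have local: "(MOST t. \<Phi> (edge n (seq_of c) t)) \<longleftrightarrow> (MOST t. \<Phi> (edge n (seq_of c') t))" for \<Phi>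
    unfolding MOST_edge_iff assms ..
  have fst_edge: "l \<in> fst (edge n (seq_of c) t) \<longleftrightarrow> t \<in> rep_pfin (c l)" if "l < n" for c l t
    using that by (simp add: edge_def seq_of_def)
  have snd_edge: "l \<in> snd (edge n (seq_of c) t) \<longleftrightarrow> Suc t \<in> rep_pfin (c l)" if "l < n" for c l t
    using that by (simp add: edge_def seq_of_def)
  show "c i = c j \<longleftrightarrow> c' i = c' j"
    using local[of "\<lambda>p. i \<in> fst p \<longleftrightarrow> j \<in> fst p"] by (simp add: fst_edge n pfin_eq_iff)
  have "c i = bot \<longleftrightarrow> (MOST t. t \<notin> rep_pfin (c i))" for c :: "nat \<Rightarrow> pfin"
    unfolding pfin_eq_iff[of _ bot] by (rule MOST_cong, rule MOST_mono[OF MOST_rep_bot]) simp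
  then show "c i = bot \<longleftrightarrow> c' i = bot"
    using local[of "\<lambda>p. i \<notin> fst p"] by (simp add: fst_edge n)
  have "c i = top \<longleftrightarrow> (MOST t. t \<in> rep_pfin (c i))" for c :: "nat \<Rightarrow> pfin"
    unfolding pfin_eq_iff[of _ top] by (rule MOST_cong, rule MOST_mono[OF MOST_rep_top]) simp
  then show "c i = top \<longleftrightarrow> c' i = top"
    using local[of "\<lambda>p. i \<in> fst p"] by (simp add: fst_edge n)
  have "c k = - c i \<longleftrightarrow> (MOST t. t \<in> rep_pfin (c k) \<longleftrightarrow> t \<notin> rep_pfin (c i))" for c :: "nat \<Rightarrow> pfin"
    unfolding pfin_eq_iff[of _ "- c i"]
    by (rule MOST_cong, rule MOST_mono[OF MOST_rep_uminus[of "c i"]]) simp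
  then show "c k = - c i \<longleftrightarrow> c' k = - c' i"
    using local[of "\<lambda>p. k \<in> fst p \<longleftrightarrow> i \<notin> fst p"] by (simp add: fst_edge n)
  have "c k = sup (c i) (c j) \<longleftrightarrow>
      (MOST t. t \<in> rep_pfin (c k) \<longleftrightarrow> t \<in> rep_pfin (c i) \<or> t \<in> rep_pfin (c j))" for c :: "nat \<Rightarrow> pfin"
    unfolding pfin_eq_iff[of _ "sup (c i) (c j)"]
    by (rule MOST_cong, rule MOST_mono[OF MOST_rep_sup[of "c i" "c j"]]) simp
  then show "c k = sup (c i) (c j) \<longleftrightarrow> c' k = sup (c' i) (c' j)"
    using local[of "\<lambda>p. k \<in> fst p \<longleftrightarrow> i \<in> fst p \<or> j \<in> fst p"] by (simp add: fst_edge n)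
  have "c k = inf (c i) (c j) \<longleftrightarrow>
      (MOST t. t \<in> rep_pfin (c k) \<longleftrightarrow> t \<in> rep_pfin (c i) \<and> t \<in> rep_pfin (c j))" for c :: "nat \<Rightarrow> pfin"
    unfolding pfin_eq_iff[of _ "inf (c i) (c j)"]
    by (rule MOST_cong, rule MOST_mono[OF MOST_rep_inf[of "c i" "c j"]]) simp
  then show "c k = inf (c i) (c j) \<longleftrightarrow> c' k = inf (c' i) (c' j)"
    using local[of "\<lambda>p. k \<in> fst p \<longleftrightarrow> i \<in> fst p \<and> j \<in> fst p"] by (simp add: fst_edge n)
  \<comment> \<open>Here both ends of an edge are compared, the second one with the first.\<close>
  have "c k = shift (c i) \<longleftrightarrow> (MOST t. Suc t \<in> rep_pfin (c k) \<longleftrightarrow> t \<in> rep_pfin (c i))"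
    for c :: "nat \<Rightarrow> pfin"
  proof -
    have "c k = shift (c i) \<longleftrightarrow>
        (MOST t. Suc t \<in> rep_pfin (c k) \<longleftrightarrow> Suc t \<in> rep_pfin (shift (c i)))"
      unfolding pfin_eq_iff[of _ "shift (c i)"]
      by (rule MOST_Suc_iff[of "\<lambda>t. t \<in> rep_pfin (c k) \<longleftrightarrow> t \<in> rep_pfin (shift (c i))", symmetric])
    also have "\<dots> \<longleftrightarrow> (MOST t. Suc t \<in> rep_pfin (c k) \<longleftrightarrow> t \<in> rep_pfin (c i))"
      by (rule MOST_cong, rule MOST_mono[OF MOST_rep_shift[of "c i"]]) simp
    finally show ?thesis .
  qed
  then show "c k = shift (c i) \<longleftrightarrow> c' k = shift (c' i)"
    using local[of "\<lambda>p. k \<in> snd p \<longleftrightarrow> i \<in> fst p"] by (simp add: fst_edge snd_edge n)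
qed

text \<open>Closure of \<open>C\<close> gives the value of every operation an index, so the previous
  equivalences make the map from \<open>c i\<close> to \<open>c' i\<close> a well-defined
  embedding.\<close>

lemma embedding_of_same_edges:
  assumes C: "closed_system C" and c: "range c = C"
    and same: "\<And>n. recurring_edges n (seq_of c) = recurring_edges n (seq_of c')"
  shows "\<exists>\<zeta>. embedding C shift UNIV shift \<zeta> \<and> (\<forall>i. \<zeta> (c i) = c' i)"
proof -
  define \<zeta> where "\<zeta> b = c' (inv_into UNIV c b)" for b
  note ops = same_edges_operations[OF same]
  have \<zeta>: "\<zeta> (c i) = c' i" for i
  proof -
    have "c (inv_into UNIV c (c i)) = c i" by (simp add: f_inv_into_f)
    then show ?thesis unfolding \<zeta>_def using ops(1) by blast
  qed
  have C_closed: "bot \<in> C" "top \<in> C" "\<And>x. x \<in> C \<Longrightarrow> - x \<in> C" "\<And>x. x \<in> C \<Longrightarrow> shift x \<in> C"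
    "\<And>x y. x \<in> C \<Longrightarrow> y \<in> C \<Longrightarrow> sup x y \<in> C" "\<And>x y. x \<in> C \<Longrightarrow> y \<in> C \<Longrightarrow> inf x y \<in> C"
    using C by (auto simp: closed_system_def subalgebra_def)
  have idx: "\<exists>i. x = c i" if "x \<in> C" for x using that c by blast
  have "\<zeta> bot = bot" using idx[OF C_closed(1)] \<zeta> ops(2) by metis
  moreover have "\<zeta> top = top" using idx[OF C_closed(2)] \<zeta> ops(3) by metis
  moreover have "\<zeta> (- x) = - \<zeta> x" if x: "x \<in> C" for x
  proof -
    obtain i k where i: "x = c i" "- x = c k" using idx[OF x] idx[OF C_closed(3)[OF x]] by blast
    then have "c k = - c i" by simp
    then have "c' k = - c' i" by (rule iffD1[OF ops(4)])
    moreover have "\<zeta> (- x) = c' k" unfolding i(2) by (rule \<zeta>)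
    ultimately show ?thesis unfolding i(1) \<zeta> by simp
  qed
  moreover have "\<zeta> (sup x y) = sup (\<zeta> x) (\<zeta> y)" if x: "x \<in> C" and y: "y \<in> C" for x y
  proof -
    obtain i j k where i: "x = c i" "y = c j" "sup x y = c k"
      using idx[OF x] idx[OF y] idx[OF C_closed(5)[OF x y]] by blast
    then have "c k = sup (c i) (c j)" by simp
    then have "c' k = sup (c' i) (c' j)" by (rule iffD1[OF ops(5)])
    moreover have "\<zeta> (sup x y) = c' k" unfolding i(3) by (rule \<zeta>)
    ultimately show ?thesis unfolding i(1,2) \<zeta> by simp
  qed
  moreover have "\<zeta> (inf x y) = inf (\<zeta> x) (\<zeta> y)" if x: "x \<in> C" and y: "y \<in> C" for x y
  proof -
    obtain i j k where i: "x = c i" "y = c j" "inf x y = c k"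
      using idx[OF x] idx[OF y] idx[OF C_closed(6)[OF x y]] by blast
    then have "c k = inf (c i) (c j)" by simp
    then have "c' k = inf (c' i) (c' j)" by (rule iffD1[OF ops(6)])
    moreover have "\<zeta> (inf x y) = c' k" unfolding i(3) by (rule \<zeta>)
    ultimately show ?thesis unfolding i(1,2) \<zeta> by simp
  qed
  moreover have "\<zeta> (shift x) = shift (\<zeta> x)" if x: "x \<in> C" for x
  proof -
    obtain i k where i: "x = c i" "shift x = c k" using idx[OF x] idx[OF C_closed(4)[OF x]] by blast
    then have "c k = shift (c i)" by simp
    then have "c' k = shift (c' i)" by (rule iffD1[OF ops(7)])
    moreover have "\<zeta> (shift x) = c' k" unfolding i(2) by (rule \<zeta>)
    ultimately show ?thesis unfolding i(1) \<zeta> by simp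
  qed
  moreover have "inj_on \<zeta> C"
  proof (rule inj_onI)
    fix x y assume xy: "x \<in> C" "y \<in> C" and eq: "\<zeta> x = \<zeta> y"
    obtain i j where "x = c i" "y = c j" using idx xy by blast
    then show "x = y" using eq \<zeta> ops(1)[of i j] by simp
  qed
  ultimately have "embedding C shift UNIV shift \<zeta>"
    by (simp add: embedding_def boolean_hom_def)
  then show ?thesis using \<zeta> by blast
qed

section \<open>Rich subsystems\<close>

text \<open>\<open>k\<close> counts the parameters and \<open>n\<close> the coordinates of the type;
  the coordinates from \<open>k\<close> up to \<open>n\<close> are the new elements.\<close>

definition rich :: "pfin set \<Rightarrow> bool" where
  "rich A \<longleftrightarrow> countable A \<and> closed_system A \<and>
     (\<forall>c k n. (\<forall>i<k. c i \<in> A) \<longrightarrow> (\<exists>c'. (\<forall>i. c' i \<in> A) \<and> (\<forall>i<k. c' i = c i) \<and>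
        recurring_edges n (seq_of c') = recurring_edges n (seq_of c)))"

lemma rich_realizes:
  assumes "rich A" and "\<forall>i<k. c i \<in> A"
  obtains c' where "\<And>i. c' i \<in> A" and "\<And>i. i < k \<Longrightarrow> c' i = c i"
    and "recurring_edges n (seq_of c') = recurring_edges n (seq_of c)"
proof -
  have "\<exists>c'. (\<forall>i. c' i \<in> A) \<and> (\<forall>i<k. c' i = c i) \<and>
      recurring_edges n (seq_of c') = recurring_edges n (seq_of c)"
    using assms by (simp add: rich_def)
  then show ?thesis using that by blast
qed

text \<open>Colour classes become additional elements of the tuple. Richness moves them into
  \<open>A\<close> without changing the recurring edges, \<open>f\<close> carries them to the side
  of \<open>c\<close>, and there they are decoded to a colouring \<open>q'\<close>.\<close>

lemma rich_transfers:
  assumes A: "rich A" and f: "embedding A shift UNIV shift f"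
    and a: "\<And>i. a i \<in> A" and fa: "\<And>i. i \<in> I \<Longrightarrow> f (a i) = c i"
  shows "transfers I (seq_of c) (\<lambda>t. seq_of a t \<inter> I) TYPE('s)"
  unfolding transfers_def
proof (intro allI impI)
  fix n and q :: "nat \<Rightarrow> 's" assume "finite (range q)"
  then obtain h :: "'s \<Rightarrow> nat" and K where h: "h ` range q = {i. i < K}" "inj_on h (range q)"
    using finite_imp_inj_to_nat_seg by blast
  have hK: "h (q t) < K" for t
  proof -
    have "h (q t) \<in> h ` range q" by blast
    then show ?thesis unfolding h(1) by simp
  qed
  define N where "N = n + K"
  \<comment> \<open>The first \<open>n\<close> entries are those of \<open>a\<close>; entry
    \<open>n + v\<close> is the class of positions whose colour has code \<open>v\<close>.\<close>
  define s where "s i = (if i < n then a i else abs_pfin {t. h (q t) = i - n})" for i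
  have "\<forall>i<n. s i \<in> A" using a by (simp add: s_def)
  then obtain s' where s': "\<And>i. s' i \<in> A" "\<And>i. i < n \<Longrightarrow> s' i = s i"
    "recurring_edges N (seq_of s') = recurring_edges N (seq_of s)"
    using rich_realizes[OF A, of n s N] by blast
  define w where "w = seq_of (\<lambda>i. f (s' i))"
  have same: "recurring_edges N w = recurring_edges N (seq_of s)"
    unfolding w_def using embedding_recurring_edges[OF _ f s'(1)] A s'(3) by (simp add: rich_def)
  \<comment> \<open>\<open>D\<close> reads the colour off a letter; it is unique for almost all
    letters of \<open>s\<close> because \<open>h\<close> is injective.\<close>
  define D where "D S = (THE v. v \<in> range q \<and> n + h v \<in> S)" for S :: "nat set"
  define q' where "q' t = D (w t \<inter> {..<N})" for t
  have D: "MOST t. D (seq_of s t \<inter> {..<N}) = q t"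
  proof -
    have "MOST t. \<forall>v\<in>range q. n + h v \<in> seq_of s t \<longleftrightarrow> h (q t) = h v"
    proof (subst MOST_finite_Ball_distrib)
      have "MOST t. n + h v \<in> seq_of s t \<longleftrightarrow> h (q t) = h v" for v
        using MOST_rep_abs[of "{t. h (q t) = h v}"] by (simp add: seq_of_def s_def)
      then show "\<forall>v\<in>range q. MOST t. n + h v \<in> seq_of s t \<longleftrightarrow> h (q t) = h v" by blast
    qed fact
    then show ?thesis
    proof (rule MOST_mono)
      fix t assume t: "\<forall>v\<in>range q. n + h v \<in> seq_of s t \<longleftrightarrow> h (q t) = h v"
      have "v \<in> range q \<and> n + h v \<in> seq_of s t \<inter> {..<N} \<longleftrightarrow> v = q t" for v
      proof
        assume v: "v \<in> range q \<and> n + h v \<in> seq_of s t \<inter> {..<N}"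
        then have "h v = h (q t)" using t by auto
        then show "v = q t" using v by (intro inj_onD[OF h(2)]) auto
      next
        assume "v = q t"
        then show "v \<in> range q \<and> n + h v \<in> seq_of s t \<inter> {..<N}"
          using t hK[of t] by (auto simp: N_def)
      qed
      then show "D (seq_of s t \<inter> {..<N}) = q t" unfolding D_def by simp
    qed
  qed
  have nN: "{..<N} \<inter> {..<n} = {..<n}" by (auto simp: N_def)
  have trunc_s: "seq_of s t \<inter> {..<N} \<inter> {..<n} \<inter> I = seq_of a t \<inter> I \<inter> {..<n}" for t
    by (auto simp: seq_of_def s_def N_def)
  \<comment> \<open>For \<open>i\<close> in \<open>I\<close> below \<open>n\<close> the entry
    \<open>f (s' i)\<close> equals \<open>f (a i)\<close>, that is \<open>c i\<close>.\<close>
  have trunc_w: "w t \<inter> {..<N} \<inter> {..<n} \<inter> I = seq_of c t \<inter> I \<inter> {..<n}" for t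
    by (auto simp: seq_of_def w_def N_def s'(2) s_def fa)
  show "\<exists>q'. \<forall>R. (MOST t. R (seq_of a t \<inter> I \<inter> {..<n}) (q t) (seq_of a (Suc t) \<inter> I \<inter> {..<n}) (q (Suc t))) \<longleftrightarrow>
      (MOST t. R (seq_of c t \<inter> I \<inter> {..<n}) (q' t) (seq_of c (Suc t) \<inter> I \<inter> {..<n}) (q' (Suc t)))"
  proof (rule exI[of _ q'], rule allI)
    fix R
    \<comment> \<open>\<open>\<Phi>\<close> states \<open>R\<close> in terms of edges of level
      \<open>N\<close>, whose recurring ones agree on both sides.\<close>
    define \<Phi> where "\<Phi> p \<longleftrightarrow> R (fst p \<inter> {..<n} \<inter> I) (D (fst p)) (snd p \<inter> {..<n} \<inter> I) (D (snd p))" for p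
    have "(MOST t. R (seq_of a t \<inter> I \<inter> {..<n}) (q t) (seq_of a (Suc t) \<inter> I \<inter> {..<n}) (q (Suc t))) \<longleftrightarrow>
        (MOST t. \<Phi> (edge N (seq_of s) t))"
      by (rule MOST_cong, rule MOST_mono[OF MOST_conjI[OF D MOST_SucI[OF D]]])
        (simp add: \<Phi>_def edge_def trunc_s)
    also have "\<dots> \<longleftrightarrow> (MOST t. \<Phi> (edge N w t))" unfolding MOST_edge_iff same ..
    also have "\<dots> \<longleftrightarrow>
        (MOST t. R (seq_of c t \<inter> I \<inter> {..<n}) (q' t) (seq_of c (Suc t) \<inter> I \<inter> {..<n}) (q' (Suc t)))"
      by (simp add: \<Phi>_def edge_def trunc_w q'_def)
    finally show "(MOST t. R (seq_of a t \<inter> I \<inter> {..<n}) (q t) (seq_of a (Suc t) \<inter> I \<inter> {..<n}) (q (Suc t))) \<longleftrightarrow>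
      (MOST t. R (seq_of c t \<inter> I \<inter> {..<n}) (q' t) (seq_of c (Suc t) \<inter> I \<inter> {..<n}) (q' (Suc t)))" .
  qed
qed

text \<open>The word of preimages under \<open>f\<close>, known only on the indices in
  \<open>I\<close>, is lifted to one with the recurring edges of an enumeration of \<open>C\<close>.
  The lifted word supplies the values of \<open>\<zeta>\<close>.\<close>

lemma rich_lifting:
  assumes A: "rich A" and f: "embedding A shift UNIV shift f"
    and C: "countable C" "closed_system C" and sub: "f ` A \<subseteq> C"
  shows "\<exists>\<zeta>. embedding C shift UNIV shift \<zeta> \<and> (\<forall>a\<in>A. \<zeta> (f a) = a)"
proof -
  have "C \<noteq> {}" using C(2) by (auto simp: closed_system_def subalgebra_def)
  define c where "c = from_nat_into C"
  have c: "range c = C" unfolding c_def using \<open>C \<noteq> {}\<close> C(1) by (rule range_from_nat_into)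
  define I where "I = {i. c i \<in> f ` A}"
  \<comment> \<open>The value \<open>bot\<close> outside \<open>I\<close> only keeps
    \<open>a\<close> inside \<open>A\<close>; the word below is intersected with
    \<open>I\<close>.\<close>
  define a where "a i = (if i \<in> I then inv_into A f (c i) else bot)" for i
  have "bot \<in> A" using A by (simp add: rich_def closed_system_def subalgebra_def)
  then have a: "a i \<in> A" for i by (simp add: a_def I_def inv_into_into)
  have fa: "f (a i) = c i" if "i \<in> I" for i using that by (simp add: a_def I_def f_inv_into_f)
  have "transfers I (seq_of c) (\<lambda>t. seq_of a t \<inter> I) TYPE(bool \<times> walk set)"
    by (rule rich_transfers[where a = a, OF A f a fa])
  from lift_sequence[OF this] obtain z where
    "\<forall>n. recurring_edges n z = recurring_edges n (seq_of c)"
    "\<forall>i\<in>I. MOST t. i \<in> z t \<longleftrightarrow> i \<in> seq_of a t \<inter> I" by (elim exE conjE)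
  then have z: "recurring_edges n z = recurring_edges n (seq_of c)"
    "i \<in> I \<Longrightarrow> MOST t. i \<in> z t \<longleftrightarrow> i \<in> seq_of a t \<inter> I" for n i by blast+
  define c' where "c' i = abs_pfin {t. i \<in> z t}" for i
  have c': "MOST t. i \<in> seq_of c' t \<longleftrightarrow> i \<in> z t" for i
    using MOST_rep_abs[of "{t. i \<in> z t}"] by (simp add: seq_of_def c'_def)
  have "recurring_edges n (seq_of c) = recurring_edges n (seq_of c')" for n
    using recurring_edges_cong[OF c', of n] z(1) by simp
  from embedding_of_same_edges[OF C(2) c this] obtain \<zeta> where
    \<zeta>: "embedding C shift UNIV shift \<zeta>" "\<And>i. \<zeta> (c i) = c' i" by blast
  have "\<zeta> (f b) = b" if b: "b \<in> A" for b
  proof -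
    have "f b \<in> range c" using sub b c by blast
    then obtain i where i: "f b = c i" by blast
    then have "c i = f b" ..
    then have iI: "i \<in> I" using b by (auto simp: I_def)
    have "f (a i) = f b" using fa[OF iI] i by simp
    then have ab: "a i = b" using f a b by (auto simp: embedding_def inj_on_eq_iff)
    have "c' i = a i"
      unfolding pfin_eq_iff
      using MOST_conjI[OF c'[of i] z(2)[OF iI]]
      by (rule MOST_mono) (use iI in \<open>simp add: seq_of_def\<close>)
    then show ?thesis using \<zeta>(2)[of i] i ab by simp
  qed
  then show ?thesis using \<zeta>(1) by blast
qed

section \<open>Elementary substructures are rich\<close>

primrec Exists_block :: "nat \<Rightarrow> nat \<Rightarrow> fm \<Rightarrow> fm" where
  "Exists_block k 0 \<phi> = \<phi>"
| "Exists_block k (Suc m) \<phi> = Exists (k + m) (Exists_block k m \<phi>)"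

lemma sat_Exists_block:
  "sat A \<alpha> e (Exists_block k m \<phi>) \<longleftrightarrow>
     (\<exists>e'. (\<forall>i. i < k \<or> k + m \<le> i \<longrightarrow> e' i = e i) \<and>
           (\<forall>i. k \<le> i \<longrightarrow> i < k + m \<longrightarrow> e' i \<in> A) \<and> sat A \<alpha> e' \<phi>)"
proof (induction m arbitrary: e)
  case 0
  have "(\<forall>i. e' i = e i) \<longleftrightarrow> e' = e" for e' :: "nat \<Rightarrow> 'a" by (auto simp: fun_eq_iff)
  moreover have "i < k \<or> k \<le> i" for i by linarith
  ultimately show ?case by (simp add: not_less[symmetric])
next
  case (Suc m)
  show ?case (is "_ \<longleftrightarrow> (\<exists>e'. ?P e')")
  proof
    assume "sat A \<alpha> e (Exists_block k (Suc m) \<phi>)"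
    then obtain x where x: "x \<in> A" "sat A \<alpha> (e(k + m := x)) (Exists_block k m \<phi>)" by auto
    from x(2) obtain e' where e': "\<forall>i. i < k \<or> k + m \<le> i \<longrightarrow> e' i = (e(k + m := x)) i"
      "\<forall>i. k \<le> i \<longrightarrow> i < k + m \<longrightarrow> e' i \<in> A" "sat A \<alpha> e' \<phi>"
      unfolding Suc.IH by blast
    have "e' i = e i" if "i < k \<or> k + Suc m \<le> i" for i
      using e'(1)[rule_format, of i] that by auto
    moreover have "e' i \<in> A" if "k \<le> i" "i < k + Suc m" for i
      using e'(1)[rule_format, of "k + m"] e'(2)[rule_format, of i] that x(1)
      by (cases "i = k + m") auto
    ultimately show "\<exists>e'. ?P e'" using e'(3) by blast
  next
    assume "\<exists>e'. ?P e'"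
    then obtain e' where e': "?P e'" by blast
    have "sat A \<alpha> (e(k + m := e' (k + m))) (Exists_block k m \<phi>)"
      unfolding Suc.IH by (rule exI[of _ e']) (use e' in auto)
    then show "sat A \<alpha> e (Exists_block k (Suc m) \<phi>)" using e' by auto
  qed
qed

lemma ex_conj_fm:
  assumes "finite F"
  shows "\<exists>\<phi>. \<forall>(A :: pfin set) e. sat A shift e \<phi> \<longleftrightarrow> (\<forall>\<psi>\<in>F. sat A shift e \<psi>)"
  using assms
proof induction
  case empty
  have "sat A shift e (Eq Zero Zero)" for A :: "pfin set" and e by simp
  then show ?case by blast
next
  case (insert \<psi> F)
  then obtain \<phi> where "\<And>(A :: pfin set) e. sat A shift e \<phi> \<longleftrightarrow> (\<forall>\<psi>\<in>F. sat A shift e \<psi>)" by blast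
  then have "\<forall>(A :: pfin set) e. sat A shift e (And \<psi> \<phi>) \<longleftrightarrow> (\<forall>\<psi>\<in>insert \<psi> F. sat A shift e \<psi>)"
    by simp
  then show ?case by (rule exI)
qed

text \<open>A finite conjunction of edge formulas and their negations. The formula is chosen
  independently of the carrier, so that elementarity can compare \<open>A\<close> with the whole
  algebra.\<close>

lemma ex_edges_fm:
  assumes "\<tau> \<subseteq> Pow {..<n} \<times> Pow {..<n}"
  shows "\<exists>\<phi>. \<forall>A e. sat A shift e \<phi> \<longleftrightarrow> recurring_edges n (seq_of e) = \<tau>"
proof -
  let ?U = "Pow {..<n} \<times> Pow {..<n}"
  define F where "F = edge_fm n ` \<tau> \<union> (\<lambda>p. Neg (edge_fm n p)) ` (?U - \<tau>)"
  have "finite F" unfolding F_def using finite_subset[OF assms] by simp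
  from ex_conj_fm[OF this] obtain \<phi> where
    \<phi>: "\<And>(A :: pfin set) e. sat A shift e \<phi> \<longleftrightarrow> (\<forall>\<psi>\<in>F. sat A shift e \<psi>)" by blast
  have "sat A shift e \<phi> \<longleftrightarrow> recurring_edges n (seq_of e) = \<tau>" for A e
  proof -
    have pos: "sat A shift e (edge_fm n p) \<longleftrightarrow> p \<in> recurring_edges n (seq_of e)" if "p \<in> ?U" for p
      using sat_edge_fm[OF that] .
    have "(\<forall>\<psi>\<in>F. sat A shift e \<psi>) \<longleftrightarrow>
        (\<forall>p\<in>\<tau>. sat A shift e (edge_fm n p)) \<and> (\<forall>p\<in>?U - \<tau>. \<not> sat A shift e (edge_fm n p))"
      unfolding F_def by (simp add: ball_Un)
    also have "\<dots> \<longleftrightarrow> (\<forall>p\<in>\<tau>. p \<in> recurring_edges n (seq_of e)) \<and>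
        (\<forall>p\<in>?U - \<tau>. p \<notin> recurring_edges n (seq_of e))"
      using pos assms by blast
    also have "\<dots> \<longleftrightarrow> recurring_edges n (seq_of e) = \<tau>"
      using recurring_edges_subset[of n "seq_of e"] by blast
    finally show ?thesis unfolding \<phi> .
  qed
  then show ?thesis by blast
qed

text \<open>Realizing a finite type over parameters is an existential statement, which holds in the
  whole algebra and therefore in \<open>A\<close>.\<close>

lemma elementary_substructure_rich:
  assumes "countable A" and A: "elementary_substructure A UNIV shift"
  shows "rich A"
proof -
  have closed: "closed_system A"
    using A by (simp add: elementary_substructure_def closed_system_def)
  then have bot: "bot \<in> A" by (simp add: closed_system_def subalgebra_def)
  have elem: "sat A shift e \<phi> \<longleftrightarrow> sat UNIV shift e \<phi>" if "\<forall>i. e i \<in> A" for e \<phi>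
    using A that by (simp add: elementary_substructure_def elementary_embedding_def)
  have "\<exists>c'. (\<forall>i. c' i \<in> A) \<and> (\<forall>i<k. c' i = c i) \<and>
        recurring_edges n (seq_of c') = recurring_edges n (seq_of c)"
    if c: "\<forall>i<k. c i \<in> A" for c k n
  proof -
    obtain \<phi> where \<phi>: "\<And>A e. sat A shift e \<phi> \<longleftrightarrow>
        recurring_edges n (seq_of e) = recurring_edges n (seq_of c)"
      using ex_edges_fm[OF recurring_edges_subset] by blast
    define e where "e i = (if i < k then c i else bot)" for i
    \<comment> \<open>The witnessing assignment: it agrees with \<open>c\<close> on the parameters
      and the quantified block, hence below \<open>n\<close>, and with \<open>e\<close>
      elsewhere.\<close>
    define e1 where "e1 i = (if i < k + n then c i else bot)" for i
    have "recurring_edges n (seq_of e1) = recurring_edges n (seq_of c)"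
      by (rule recurring_edges_cong) (simp add: seq_of_def e1_def)
    then have "sat UNIV shift e (Exists_block k n \<phi>)"
      unfolding sat_Exists_block \<phi> by (intro exI[of _ e1]) (auto simp: e_def e1_def)
    moreover have e_in: "\<forall>i. e i \<in> A" using c bot by (simp add: e_def)
    ultimately have "sat A shift e (Exists_block k n \<phi>)" using elem by blast
    then obtain e' where e': "\<forall>i. i < k \<or> k + n \<le> i \<longrightarrow> e' i = e i"
      "\<forall>i. k \<le> i \<longrightarrow> i < k + n \<longrightarrow> e' i \<in> A"
      "recurring_edges n (seq_of e') = recurring_edges n (seq_of c)"
      unfolding sat_Exists_block \<phi> by blast
    have "e' i \<in> A" for i using e'(1,2) e_in by (metis not_less)
    moreover have "\<forall>i<k. e' i = c i" using e'(1) by (simp add: e_def)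
    ultimately show ?thesis using e'(3) by blast
  qed
  then show ?thesis using assms(1) closed unfolding rich_def by blast
qed

section \<open>Countable rich hulls\<close>

lemma finite_subset_UN_chain:
  assumes "finite S" "S \<subseteq> (\<Union>m. F m)" "mono (F :: nat \<Rightarrow> 'a set)"
  shows "\<exists>m. S \<subseteq> F m"
  using assms(1,2)
proof induction
  case empty
  then show ?case by simp
next
  case (insert x S)
  then obtain m l where "S \<subseteq> F m" "x \<in> F l" by auto
  moreover have "F m \<subseteq> F (max m l)" "F l \<subseteq> F (max m l)"
    using assms(3) by (simp_all add: monoD)
  ultimately have "insert x S \<subseteq> F (max m l)" by blast
  then show ?case by blast
qed

text \<open>For a type that is not realized this is an arbitrary tuple, which may be added to the
  hull without harm.\<close>

definition type_witness :: "pfin list \<Rightarrow> nat \<Rightarrow> (nat set \<times> nat set) set \<Rightarrow> nat \<Rightarrow> pfin" where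
  "type_witness xs n \<tau> =
     (SOME c. (\<forall>i<length xs. c i = xs ! i) \<and> recurring_edges n (seq_of c) = \<tau>)"

definition enrich :: "pfin set \<Rightarrow> pfin set" where
  "enrich X = X \<union> {bot, top} \<union> uminus ` X \<union> shift ` X \<union> inv_into UNIV shift ` X \<union>
     case_prod sup ` (X \<times> X) \<union> case_prod inf ` (X \<times> X) \<union>
     (\<Union>xs\<in>lists X. \<Union>n. \<Union>\<tau>\<in>Pow (Pow {..<n} \<times> Pow {..<n}). range (type_witness xs n \<tau>))"

lemma countable_enrich:
  assumes "countable X"
  shows "countable (enrich X)"
proof -
  have "countable (Pow (Pow {..<n} \<times> Pow {..<n}))" for n :: nat
    by (rule countable_finite) simp
  then have "countable (\<Union>xs\<in>lists X. \<Union>n.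
      \<Union>\<tau>\<in>Pow (Pow {..<n} \<times> Pow {..<n}). range (type_witness xs n \<tau>))"
    using countable_lists[OF assms] by (intro countable_UN countable_image countableI_type)
  then show ?thesis using assms by (simp add: enrich_def)
qed

text \<open>A downward Loewenheim-Skolem argument: iterate \<open>enrich\<close> countably often.
  Finitely many parameters lie in one stage, and the next stage contains the required
  values.\<close>

lemma rich_hull:
  assumes "countable X"
  shows "\<exists>C. rich C \<and> X \<subseteq> C"
proof -
  define F where "F m = (enrich ^^ m) X" for m
  have F_Suc: "F (Suc m) = enrich (F m)" for m by (simp add: F_def)
  have "mono F"
    by (rule mono_iff_le_Suc[THEN iffD2]) (auto simp: F_Suc enrich_def)
  define C where "C = (\<Union>m. F m)"
  have "countable (F m)" for m
    by (induction m) (simp_all add: F_Suc countable_enrich, simp add: F_def assms)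
  then have "countable C" by (simp add: C_def)
  have step: "y \<in> C" if "y \<in> enrich (F m)" for y m
    using that unfolding C_def F_Suc[symmetric] by blast
  have fin: "\<exists>m. S \<subseteq> F m" if "finite S" "S \<subseteq> C" for S
    using finite_subset_UN_chain[OF that(1) _ \<open>mono F\<close>] that(2) by (simp add: C_def)
  have "bot \<in> C" "top \<in> C" by (rule step[of _ 0], simp add: enrich_def)+
  moreover have "- x \<in> C" "shift x \<in> C" "inv_into UNIV shift x \<in> C" if x: "x \<in> C" for x
  proof -
    obtain m where "x \<in> F m" using x by (auto simp: C_def)
    then show "- x \<in> C" "shift x \<in> C" "inv_into UNIV shift x \<in> C"
      by (auto intro!: step[of _ m] simp: enrich_def)
  qed
  moreover have "sup x y \<in> C" "inf x y \<in> C" if "x \<in> C" "y \<in> C" for x y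
  proof -
    obtain m where m: "x \<in> F m" "y \<in> F m" using fin[of "{x, y}"] \<open>x \<in> C\<close> \<open>y \<in> C\<close> by auto
    have "sup x y \<in> case_prod sup ` (F m \<times> F m)" "inf x y \<in> case_prod inf ` (F m \<times> F m)"
      using m by force+
    then show "sup x y \<in> C" "inf x y \<in> C"
      by (auto intro!: step[of _ m] simp: enrich_def simp del: mem_Sigma_iff)
  qed
  ultimately have "closed_system C" by (simp add: closed_system_def subalgebra_def)
  have "\<exists>c'. (\<forall>i. c' i \<in> C) \<and> (\<forall>i<k. c' i = c i) \<and>
        recurring_edges n (seq_of c') = recurring_edges n (seq_of c)"
    if c: "\<forall>i<k. c i \<in> C" for c k n
  proof -
    define xs where "xs = map c [0..<k]"
    define \<tau> where "\<tau> = recurring_edges n (seq_of c)"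
    define c' where "c' = type_witness xs n \<tau>"
    have "(\<forall>i<length xs. c i = xs ! i) \<and> recurring_edges n (seq_of c) = \<tau>"
      by (simp add: xs_def \<tau>_def)
    then have c': "(\<forall>i<length xs. c' i = xs ! i) \<and> recurring_edges n (seq_of c') = \<tau>"
      unfolding c'_def type_witness_def
      by (rule someI[where P = "\<lambda>c. (\<forall>i<length xs. c i = xs ! i) \<and> recurring_edges n (seq_of c) = \<tau>"])
    have "set xs \<subseteq> C" using c by (auto simp: xs_def)
    then obtain m where "set xs \<subseteq> F m" using fin[of "set xs"] by auto
    then have xs: "xs \<in> lists (F m)" by auto
    have \<tau>: "\<tau> \<in> Pow (Pow {..<n} \<times> Pow {..<n})" unfolding \<tau>_def using recurring_edges_subset by blast
    have "c' i \<in> enrich (F m)" for i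
      unfolding enrich_def c'_def
      by (rule UnI2, rule UN_I, rule xs, rule UN_I, rule UNIV_I, rule UN_I, rule \<tau>, rule rangeI)
    then have "\<forall>i. c' i \<in> C" using step by blast
    moreover have "\<forall>i<k. c' i = c i" using c' by (simp add: xs_def)
    ultimately show ?thesis using c' by (auto simp: \<tau>_def)
  qed
  then have "rich C" using \<open>countable C\<close> \<open>closed_system C\<close> unfolding rich_def by blast
  moreover have "X \<subseteq> C"
  proof -
    have "F 0 = X" by (simp add: F_def)
    then show ?thesis by (auto simp: C_def)
  qed
  ultimately show ?thesis by blast
qed

text \<open>Lifting twice extends both the domain and the range of an embedding.\<close>

lemma rich_back_and_forth:
  assumes A: "rich A" and f: "embedding A shift UNIV shift f"
  shows "\<exists>D \<xi> b. rich D \<and> embedding D shift UNIV shift \<xi> \<and> A \<subseteq> D \<and> d \<in> D \<and>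
           b \<in> D \<and> \<xi> b = c \<and> (\<forall>a\<in>A. \<xi> a = f a)"
proof -
  have "countable (insert c (f ` A))" using A by (simp add: rich_def)
  then obtain C where C: "rich C" "insert c (f ` A) \<subseteq> C" using rich_hull by blast
  have C': "countable C" "closed_system C" using C(1) by (simp_all add: rich_def)
  obtain \<zeta> where \<zeta>: "embedding C shift UNIV shift \<zeta>" "\<forall>a\<in>A. \<zeta> (f a) = a"
    using rich_lifting[OF A f C'] C(2) by blast
  have "countable (insert d (\<zeta> ` C))" using C' by simp
  then obtain D where D: "rich D" "insert d (\<zeta> ` C) \<subseteq> D" using rich_hull by blast
  have D': "countable D" "closed_system D" using D(1) by (simp_all add: rich_def)
  obtain \<xi> where \<xi>: "embedding D shift UNIV shift \<xi>" "\<forall>x\<in>C. \<xi> (\<zeta> x) = x"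
    using rich_lifting[OF C(1) \<zeta>(1) D'] D(2) by blast
  have fa: "\<xi> a = f a \<and> a \<in> D" if "a \<in> A" for a
  proof -
    have "f a \<in> C" using C(2) that by blast
    then have "\<xi> (\<zeta> (f a)) = f a" "\<zeta> (f a) \<in> D" using \<xi>(2) D(2) by auto
    then show ?thesis using \<zeta>(2) that by simp
  qed
  moreover have "c \<in> C" using C(2) by blast
  then have "\<xi> (\<zeta> c) = c" "\<zeta> c \<in> D" using \<xi>(2) D(2) by auto
  moreover have "d \<in> D" using D(2) by blast
  ultimately show ?thesis using D(1) \<xi>(1) by blast
qed

text \<open>One round of the back-and-forth game. The extension \<open>\<xi>\<close> handles both a
  prescribed value \<open>c\<close> and a prescribed argument \<open>d\<close>, and
  \<open>IH\<close> is applied to its rich domain \<open>D\<close>.\<close>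

lemma rich_extension_sat:
  assumes A: "rich A" and f: "embedding A shift UNIV shift f" and e: "\<forall>i. e i \<in> A"
    and IH: "\<And>D \<xi> e. rich D \<Longrightarrow> embedding D shift UNIV shift \<xi> \<Longrightarrow> \<forall>i. e i \<in> D \<Longrightarrow>
               sat UNIV shift (\<lambda>i. \<xi> (e i)) \<phi> \<longleftrightarrow> sat UNIV shift e \<phi>"
  shows "\<exists>b. sat UNIV shift ((\<lambda>i. f (e i))(j := c)) \<phi> = sat UNIV shift (e(j := b)) \<phi>"
    and "\<exists>c. sat UNIV shift ((\<lambda>i. f (e i))(j := c)) \<phi> = sat UNIV shift (e(j := d)) \<phi>"
proof -
  obtain D \<xi> b where D: "rich D" "embedding D shift UNIV shift \<xi>" "A \<subseteq> D" "d \<in> D" "b \<in> D"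
    "\<xi> b = c" "\<forall>a\<in>A. \<xi> a = f a"
    using rich_back_and_forth[OF A f, of d c] by blast
  have *: "sat UNIV shift ((\<lambda>i. f (e i))(j := \<xi> x)) \<phi> = sat UNIV shift (e(j := x)) \<phi>"
    if "x \<in> D" for x
  proof -
    have "(\<lambda>i. \<xi> ((e(j := x)) i)) = (\<lambda>i. f (e i))(j := \<xi> x)"
      using D(7) e by (auto simp: fun_eq_iff)
    moreover have "\<forall>i. (e(j := x)) i \<in> D" using that D(3) e by auto
    ultimately show ?thesis using IH[OF D(1,2), of "e(j := x)"] by simp
  qed
  show "\<exists>b. sat UNIV shift ((\<lambda>i. f (e i))(j := c)) \<phi> = sat UNIV shift (e(j := b)) \<phi>"
    using *[OF D(5)] D(6) by blast
  show "\<exists>c. sat UNIV shift ((\<lambda>i. f (e i))(j := c)) \<phi> = sat UNIV shift (e(j := d)) \<phi>"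
    using *[OF D(4)] by blast
qed

text \<open>Both sides are evaluated in the whole algebra; \<open>A\<close> only confines the
  parameters. The induction runs over all rich systems simultaneously because a quantifier enlarges
  the system.\<close>

lemma rich_embedding_sat:
  assumes "rich A" and "embedding A shift UNIV shift f" and "\<forall>i. e i \<in> A"
  shows "sat UNIV shift (\<lambda>i. f (e i)) \<phi> \<longleftrightarrow> sat UNIV shift e \<phi>"
  using assms
proof (induction \<phi> arbitrary: A f e)
  case (Eq s t)
  have A: "closed_system A" using Eq.prems(1) by (simp add: rich_def)
  have e: "e i \<in> A" for i using Eq.prems(3) by blast
  have "inj_on f A" using Eq.prems(2) by (simp add: embedding_def)
  then show ?case
    unfolding sat.simps tm_val_embedding[OF A Eq.prems(2) e]
    using tm_val_closed[OF A e] by (simp add: inj_on_eq_iff)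
next
  case (Le s t)
  have A: "closed_system A" using Le.prems(1) by (simp add: rich_def)
  have e: "e i \<in> A" for i using Le.prems(3) by blast
  have "subalgebra A" using A by (simp add: closed_system_def)
  from embedding_le_iff[OF this Le.prems(2)] show ?case
    unfolding sat.simps tm_val_embedding[OF A Le.prems(2) e]
    using tm_val_closed[OF A e] by simp
next
  case (Neg \<phi>)
  show ?case using Neg.IH[OF Neg.prems] by simp
next
  case (And \<phi> \<psi>)
  show ?case using And.IH(1)[OF And.prems] And.IH(2)[OF And.prems] by simp
next
  case (Or \<phi> \<psi>)
  show ?case using Or.IH(1)[OF Or.prems] Or.IH(2)[OF Or.prems] by simp
next
  case (Imp \<phi> \<psi>)
  show ?case using Imp.IH(1)[OF Imp.prems] Imp.IH(2)[OF Imp.prems] by simp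
next
  case (Exists j \<phi>)
  have "\<exists>b. sat UNIV shift ((\<lambda>i. f (e i))(j := c)) \<phi> = sat UNIV shift (e(j := b)) \<phi>" for c
    by (rule rich_extension_sat(1)[OF Exists.prems]) (rule Exists.IH)
  moreover have "\<exists>c. sat UNIV shift ((\<lambda>i. f (e i))(j := c)) \<phi> = sat UNIV shift (e(j := d)) \<phi>" for d
    by (rule rich_extension_sat(2)[OF Exists.prems]) (rule Exists.IH)
  ultimately show ?case unfolding sat.simps by blast
next
  case (Forall j \<phi>)
  have "\<exists>b. sat UNIV shift ((\<lambda>i. f (e i))(j := c)) \<phi> = sat UNIV shift (e(j := b)) \<phi>" for c
    by (rule rich_extension_sat(1)[OF Forall.prems]) (rule Forall.IH)
  moreover have "\<exists>c. sat UNIV shift ((\<lambda>i. f (e i))(j := c)) \<phi> = sat UNIV shift (e(j := d)) \<phi>" for d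
    by (rule rich_extension_sat(2)[OF Forall.prems]) (rule Forall.IH)
  ultimately show ?case unfolding sat.simps by blast
qed

theorem theorem12p4:
  fixes A :: "pfin set" and \<eta> :: "pfin \<Rightarrow> pfin"
  assumes "countable A"
    and "elementary_substructure A UNIV shift"
    and "embedding A shift UNIV shift \<eta>"
  shows "elementary_embedding A shift UNIV shift \<eta>"
proof -
  have "sat A shift e \<phi> \<longleftrightarrow> sat UNIV shift (\<lambda>i. \<eta> (e i)) \<phi>" if e: "\<forall>i. e i \<in> A" for e \<phi>
  proof -
    \<comment> \<open>Elementarity replaces truth in \<open>A\<close> by truth in the whole algebra,
      where the back-and-forth result applies.\<close>
    have "sat A shift e \<phi> \<longleftrightarrow> sat UNIV shift e \<phi>"
      using assms(2) e by (simp add: elementary_substructure_def elementary_embedding_def)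
    then show ?thesis
      using rich_embedding_sat[OF elementary_substructure_rich[OF assms(1,2)] assms(3)] e by simp
  qed
  then show ?thesis using assms(3) by (simp add: elementary_embedding_def)
qed

end
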